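(* Let $A$ be a Hopf-Galois algebra with Hopf-Galois map $\mu$, let $H=A[z;\tau,\delta]$ be an Ore extension of $A$, and let $g$ be a group-like element of $A$. Suppose that $\tau$ is an algebra automorphism. Then $H=A[z;\tau,\delta]$ is a Hopf-Galois Ore extension of $A$ whose Hopf-Galois map (again denoted $\mu$) is determined by $$\mu(z)=z\otimes 1\otimes 1+g\otimes g^{-1}\otimes z-g\otimes g^{-1}z\otimes 1$$ if and only if the following conditions are satisfied for all $a\in A$: (1) $\mu(\tau(a))=\tau(a_{(1)})\otimes a_{(2)}\otimes a_{(3)}=\tau(a_{(1)})\otimes \tau(a_{(2)})\otimes \tau(a_{(3)})$; (2) $g\cdot a_{(1)}\otimes g\cdot a_{(2)}\otimes a_{(3)}=\tau(a_{(1)})\otimes \tau(a_{(2)})\otimes a_{(3)}$; (3) $\delta(a_{(1)})\otimes a_{(2)}\otimes a_{(3)}+ga_{(1)}\otimes a_{(2)}g^{-1}\otimes \delta(a_{(3)})+ga_{(1)}\otimes g^{-1}\delta(\tau^{-1}(g\cdot a_{(2)}))\otimes a_{(3)}=\mu(\delta(a))$.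
   Context: Everything is over a fixed field $k$; algebras are associative and unital, and $\otimes=\otimes_k$. A Hopf-Galois algebra is a non-zero algebra $R$ together with an algebra map $\mu:R\to R\otimes R^{op}\otimes R$ (tensor product algebra; called the Hopf-Galois map), written $\mu(r)=r_{(1)}\otimes r_{(2)}\otimes r_{(3)}$ with summation suppressed, such that $(\mu\otimes id\otimes id)\circ\mu=(id\otimes id\otimes\mu)\circ\mu$, $(m\otimes id)\circ\mu=\eta\otimes id$ and $(id\otimes m)\circ\mu=id\otimes\eta$, where $m$ and $\eta$ are the multiplication and unit of $R$; that is, for all $r\in R$, $r_{(1)}r_{(2)}\otimes r_{(3)}=1\otimes r$ and $r_{(1)}\otimes r_{(2)}r_{(3)}=r\otimes 1$ (products in $R$). In expressions such as $g\otimes g^{-1}z\otimes 1$ or $a_{(2)}g^{-1}$, products written inside a tensor factor are products in the original algebra (not in its opposite). A group-like element of $R$ is an invertible $g\in R$ with $\mu(g)=g\otimes g^{-1}\otimes g$; for such $g$ write $g\cdot r:=grg^{-1}$. Ore extension: for an algebra $A$, an algebra endomorphism $\tau$ of $A$ and a $\tau$-derivation $\delta$ (a $k$-linear map $A\to A$ with $\delta(ab)=\tau(a)\delta(b)+\delta(a)b$), $A[z;\tau,\delta]$ is the algebra generated by $A$ and the variable $z$ with relation $za=\tau(a)z+\delta(a)$ for all $a\in A$; if $\{a_i\}$ is a $k$-basis of $A$ then $\{a_iz^j : j\ge 0\}$ is a $k$-basis of it. $H=A[z;\tau,\delta]$ is called a Hopf-Galois Ore extension of the Hopf-Galois algebra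 $A$ if $H$ is a Hopf-Galois algebra with $A$ as a Hopf-Galois subalgebra, i.e. the Hopf-Galois map of $H$ restricts on $A$ to that of $A$. *)

theory Defs
  imports "HOL-Library.Poly_Mapping" "HOL-Computational_Algebra.Polynomial"
begin

text \<open>The class \<^class>\<open>ring_1\<close> contains \<open>0 \<noteq> 1\<close>, so all algebras below are non-zero.\<close>

locale k_algebra = vector_space scale
  for scale :: "'k::field \<Rightarrow> 'a::ring_1 \<Rightarrow> 'a" +
  assumes scale_mult_left: "scale c x * y = scale c (x * y)"
    and scale_mult_right: "x * scale c y = scale c (x * y)"

definition algebra_hom ::
    "('k::field \<Rightarrow> 'a::ring_1 \<Rightarrow> 'a) \<Rightarrow> ('k \<Rightarrow> 'b::ring_1 \<Rightarrow> 'b) \<Rightarrow> ('a \<Rightarrow> 'b) \<Rightarrow> bool" where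
  "algebra_hom s s' f \<longleftrightarrow> Vector_Spaces.linear s s' f \<and> f 1 = 1 \<and> (\<forall>x y. f (x * y) = f x * f y)"

definition invertible_elt :: "'a::ring_1 \<Rightarrow> bool" where
  "invertible_elt g \<longleftrightarrow> (\<exists>h. g * h = 1 \<and> h * g = 1)"

definition inv_elt :: "'a::ring_1 \<Rightarrow> 'a" where
  "inv_elt g = (THE h. g * h = 1 \<and> h * g = 1)"

definition conj_by :: "'a::ring_1 \<Rightarrow> 'a \<Rightarrow> 'a" where
  "conj_by g r = g * r * inv_elt g"

text \<open>
  For \<open>n \<ge> 1\<close> the \<open>n\<close>-fold tensor power over \<open>k\<close> of a \<open>k\<close>-vector space \<open>V\<close> is the quotient of the
  free abelian group on \<open>V\<^sup>n\<close> (lists of length \<open>n\<close>) by the subgroup generated by the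
  additivity relations and the \<open>k\<close>-balancing relations
  \<open>\<dots> \<otimes> c v\<^sub>i \<otimes> \<dots> \<otimes> v\<^sub>j \<otimes> \<dots> = \<dots> \<otimes> v\<^sub>i \<otimes> \<dots> \<otimes> c v\<^sub>j \<otimes> \<dots>\<close>; scalars act through any one factor.
  A tensor is a coset of that subgroup.  (Only \<open>n = 2, 3, 5\<close> are used.)  As \<open>R\<^sup>o\<^sup>p\<close> and \<open>R\<close> have the
  same underlying vector space, the underlying space of \<open>R \<otimes> R\<^sup>o\<^sup>p \<otimes> R\<close> is the third tensor power
  of \<open>R\<close>.
\<close>

inductive_set tensor_relations ::
    "('k::field \<Rightarrow> 'a::ab_group_add \<Rightarrow> 'a) \<Rightarrow> nat \<Rightarrow> ('a list \<Rightarrow>\<^sub>0 int) set"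
  for s :: "'k \<Rightarrow> 'a \<Rightarrow> 'a" and n :: nat where
  zero: "0 \<in> tensor_relations s n"
| diff: "x \<in> tensor_relations s n \<Longrightarrow> y \<in> tensor_relations s n \<Longrightarrow> x - y \<in> tensor_relations s n"
| additive: "length w = n \<Longrightarrow> i < n \<Longrightarrow>
    frag_of (w[i := a + b]) - frag_of (w[i := a]) - frag_of (w[i := b]) \<in> tensor_relations s n"
| balanced: "length w = n \<Longrightarrow> i < n \<Longrightarrow> j < n \<Longrightarrow>
    frag_of (w[i := s c (w ! i)]) - frag_of (w[j := s c (w ! j)]) \<in> tensor_relations s n"

type_synonym 'a tensor = "('a list \<Rightarrow>\<^sub>0 int) set"

definition tensor_class ::
    "('k::field \<Rightarrow> 'a::ab_group_add \<Rightarrow> 'a) \<Rightarrow> nat \<Rightarrow> ('a list \<Rightarrow>\<^sub>0 int) \<Rightarrow> 'a tensor" where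
  "tensor_class s n x = {y. y - x \<in> tensor_relations s n}"

definition tensor_power ::
    "('k::field \<Rightarrow> 'a::ab_group_add \<Rightarrow> 'a) \<Rightarrow> nat \<Rightarrow> 'a tensor set" where
  "tensor_power s n = tensor_class s n ` {x. \<forall>w\<in>Poly_Mapping.keys x. length w = n}"

text \<open>\<open>pure s [a\<^sub>1, \<dots>, a\<^sub>n]\<close> is \<open>a\<^sub>1 \<otimes> \<dots> \<otimes> a\<^sub>n\<close>.\<close>

definition pure :: "('k::field \<Rightarrow> 'a::ab_group_add \<Rightarrow> 'a) \<Rightarrow> 'a list \<Rightarrow> 'a tensor" where
  "pure s w = tensor_class s (length w) (frag_of w)"

definition tensor_add :: "'a tensor \<Rightarrow> 'a tensor \<Rightarrow> 'a tensor"  (infixl "\<oplus>\<^sub>t" 65) where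
  "X \<oplus>\<^sub>t Y = {x + y | x y. x \<in> X \<and> y \<in> Y}"

definition tensor_diff :: "'a tensor \<Rightarrow> 'a tensor \<Rightarrow> 'a tensor"  (infixl "\<ominus>\<^sub>t" 65) where
  "X \<ominus>\<^sub>t Y = {x - y | x y. x \<in> X \<and> y \<in> Y}"

text \<open>
  \<open>tensor_lift s n \<phi>\<close> is the additive map into the \<open>n\<close>-th tensor power of the space with scalar
  multiplication \<open>s\<close> that is induced by a multilinear map \<open>\<phi>\<close> with values in that tensor power;
  see \<open>tensor_lift_pure\<close> and \<open>tensor_lift_add\<close> below.
\<close>

definition tensor_lift ::
    "('k::field \<Rightarrow> 'a::ab_group_add \<Rightarrow> 'a) \<Rightarrow> nat \<Rightarrow> ('b list \<Rightarrow> 'a tensor) \<Rightarrow> 'b tensor \<Rightarrow> 'a tensor" where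
  "tensor_lift s n \<phi> X = (\<Union>x\<in>X. tensor_class s n (frag_extend (\<lambda>w. SOME y. y \<in> \<phi> w) x))"

text \<open>
  Sweedler-style version for triple tensors: if \<open>X = x\<^sub>(\<^sub>1\<^sub>) \<otimes> x\<^sub>(\<^sub>2\<^sub>) \<otimes> x\<^sub>(\<^sub>3\<^sub>)\<close> (summation suppressed), then
  \<open>tensor_lift3 s n \<phi> X\<close> is \<open>\<phi> x\<^sub>(\<^sub>1\<^sub>) x\<^sub>(\<^sub>2\<^sub>) x\<^sub>(\<^sub>3\<^sub>)\<close>.
\<close>

definition tensor_lift3 ::
    "('k::field \<Rightarrow> 'a::ab_group_add \<Rightarrow> 'a) \<Rightarrow> nat \<Rightarrow> ('b \<Rightarrow> 'b \<Rightarrow> 'b \<Rightarrow> 'a tensor) \<Rightarrow> 'b tensor \<Rightarrow> 'a tensor" where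
  "tensor_lift3 s n \<phi> X = tensor_lift s n (\<lambda>w. \<phi> (w ! 0) (w ! 1) (w ! 2)) X"

definition tensor3_scale :: "('k::field \<Rightarrow> 'a::ab_group_add \<Rightarrow> 'a) \<Rightarrow> 'k \<Rightarrow> 'a tensor \<Rightarrow> 'a tensor" where
  "tensor3_scale s c X = tensor_lift3 s 3 (\<lambda>x y z. pure s [s c x, y, z]) X"

text \<open>Multiplication of the algebra \<open>R \<otimes> R\<^sup>o\<^sup>p \<otimes> R\<close>.\<close>

definition tensor3_mult ::
    "('k::field \<Rightarrow> 'a::ring_1 \<Rightarrow> 'a) \<Rightarrow> 'a tensor \<Rightarrow> 'a tensor \<Rightarrow> 'a tensor" where
  "tensor3_mult s X Y =
     tensor_lift3 s 3 (\<lambda>a b c. tensor_lift3 s 3 (\<lambda>a' b' c'. pure s [a * a', b' * b, c * c']) Y) X"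

locale hopf_galois_algebra = k_algebra scale
  for scale :: "'k::field \<Rightarrow> 'a::ring_1 \<Rightarrow> 'a" +
  fixes \<mu> :: "'a \<Rightarrow> 'a tensor"
  assumes mu_closed: "\<mu> r \<in> tensor_power scale 3"
    and mu_add: "\<mu> (r + r') = \<mu> r \<oplus>\<^sub>t \<mu> r'"
    and mu_scale: "\<mu> (scale c r) = tensor3_scale scale c (\<mu> r)"
    and mu_one: "\<mu> 1 = pure scale [1, 1, 1]"
    and mu_mult: "\<mu> (r * r') = tensor3_mult scale (\<mu> r) (\<mu> r')"
    and mu_coassoc:
      "tensor_lift3 scale 5 (\<lambda>a b c. tensor_lift3 scale 5 (\<lambda>x y z. pure scale [x, y, z, b, c]) (\<mu> a)) (\<mu> r)
     = tensor_lift3 scale 5 (\<lambda>a b c. tensor_lift3 scale 5 (\<lambda>x y z. pure scale [a, b, x, y, z]) (\<mu> c)) (\<mu> r)"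
    and mu_counit_left: "tensor_lift3 scale 2 (\<lambda>a b c. pure scale [a * b, c]) (\<mu> r) = pure scale [1, r]"
    and mu_counit_right: "tensor_lift3 scale 2 (\<lambda>a b c. pure scale [a, b * c]) (\<mu> r) = pure scale [r, 1]"

definition group_like :: "('k::field \<Rightarrow> 'a::ring_1 \<Rightarrow> 'a) \<Rightarrow> ('a \<Rightarrow> 'a tensor) \<Rightarrow> 'a \<Rightarrow> bool" where
  "group_like s \<mu> g \<longleftrightarrow> invertible_elt g \<and> \<mu> g = pure s [g, inv_elt g, g]"

text \<open>
  \<open>ore_extension s\<^sub>A \<tau> \<delta> s\<^sub>H \<iota> z\<close>: the algebra on the type \<open>'h\<close>, together with the structure map
  \<open>\<iota> : A \<rightarrow> H\<close> and the element \<open>z\<close>, is \<open>A[z; \<tau>, \<delta>]\<close>.  The assumption \<open>ore_basis\<close> says that \<open>H\<close> is free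
  as a left \<open>A\<close>-module on the powers of \<open>z\<close>: every element is \<open>\<Sum>\<^sub>i \<iota> a\<^sub>i z\<^sup>i\<close> for a unique finitely supported
  sequence \<open>(a\<^sub>i)\<close>, encoded as an element of \<open>'a poly\<close> (whose own multiplication plays no role).
  In particular \<open>\<iota>\<close> is injective.  Lemma \<open>ore_extension_universal\<close> shows that such an \<open>H\<close> is
  the algebra generated by \<open>A\<close> and \<open>z\<close> subject to the relations \<open>z a = \<tau> a z + \<delta> a\<close>.
\<close>

locale ore_extension = A: k_algebra scaleA + H: k_algebra scaleH
  for scaleA :: "'k::field \<Rightarrow> 'a::ring_1 \<Rightarrow> 'a"
    and \<tau> :: "'a \<Rightarrow> 'a"
    and \<delta> :: "'a \<Rightarrow> 'a"
    and scaleH :: "'k \<Rightarrow> 'h::ring_1 \<Rightarrow> 'h"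
    and \<iota> :: "'a \<Rightarrow> 'h"
    and z :: 'h +
  assumes tau_hom: "algebra_hom scaleA scaleA \<tau>"
    and delta_linear: "Vector_Spaces.linear scaleA scaleA \<delta>"
    and delta_mult: "\<delta> (a * b) = \<tau> a * \<delta> b + \<delta> a * b"
    and iota_hom: "algebra_hom scaleA scaleH \<iota>"
    and ore_relation: "z * \<iota> a = \<iota> (\<tau> a) * z + \<iota> (\<delta> a)"
    and ore_basis: "bij (\<lambda>p :: 'a poly. \<Sum>i\<le>degree p. \<iota> (poly.coeff p i) * z ^ i)"

definition hopf_galois_ore_extension ::
    "('k::field \<Rightarrow> 'a::ring_1 \<Rightarrow> 'a) \<Rightarrow> ('a \<Rightarrow> 'a tensor) \<Rightarrow> ('a \<Rightarrow> 'a) \<Rightarrow> ('a \<Rightarrow> 'a) \<Rightarrow>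
     ('k \<Rightarrow> 'h::ring_1 \<Rightarrow> 'h) \<Rightarrow> ('a \<Rightarrow> 'h) \<Rightarrow> 'h \<Rightarrow> ('h \<Rightarrow> 'h tensor) \<Rightarrow> bool" where
  "hopf_galois_ore_extension s\<^sub>A \<mu> \<tau> \<delta> s\<^sub>H \<iota> z \<mu>\<^sub>H \<longleftrightarrow>
     hopf_galois_algebra s\<^sub>A \<mu> \<and> ore_extension s\<^sub>A \<tau> \<delta> s\<^sub>H \<iota> z \<and> hopf_galois_algebra s\<^sub>H \<mu>\<^sub>H \<and>
     (\<forall>a. \<mu>\<^sub>H (\<iota> a) = tensor_lift3 s\<^sub>H 3 (\<lambda>x y w. pure s\<^sub>H [\<iota> x, \<iota> y, \<iota> w]) (\<mu> a))"

lemma tensor_relations_uminus: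
  "x \<in> tensor_relations s n \<Longrightarrow> - x \<in> tensor_relations s n"
  using tensor_relations.diff[OF tensor_relations.zero] by fastforce

lemma tensor_relations_add:
  "x \<in> tensor_relations s n \<Longrightarrow> y \<in> tensor_relations s n \<Longrightarrow> x + y \<in> tensor_relations s n"
  using tensor_relations.diff[OF _ tensor_relations_uminus] by fastforce

lemma tensor_class_self: "x \<in> tensor_class s n x"
  by (simp add: tensor_class_def tensor_relations.zero)

lemma tensor_class_eq_iff: "tensor_class s n x = tensor_class s n y \<longleftrightarrow> x - y \<in> tensor_relations s n"
proof
  assume "tensor_class s n x = tensor_class s n y"
  then show "x - y \<in> tensor_relations s n"
    using tensor_class_self[of x s n] by (simp add: tensor_class_def)
next
  assume xy: "x - y \<in> tensor_relations s n"
  have "u - x \<in> tensor_relations s n \<longleftrightarrow> u - y \<in> tensor_relations s n" for u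
    using tensor_relations_add[OF _ xy, of "u - x"] tensor_relations.diff[OF _ xy, of "u - y"]
    by auto
  then show "tensor_class s n x = tensor_class s n y"
    by (simp add: tensor_class_def)
qed

lemma tensor_class_add: "tensor_class s n x \<oplus>\<^sub>t tensor_class s n y = tensor_class s n (x + y)"
proof (intro set_eqI iffI)
  fix u assume "u \<in> tensor_class s n x \<oplus>\<^sub>t tensor_class s n y"
  then obtain v w where "u = v + w" "v - x \<in> tensor_relations s n" "w - y \<in> tensor_relations s n"
    by (auto simp: tensor_add_def tensor_class_def)
  then show "u \<in> tensor_class s n (x + y)"
    using tensor_relations_add[of "v - x" s n "w - y"] by (simp add: tensor_class_def algebra_simps)
next
  fix u assume "u \<in> tensor_class s n (x + y)"
  then have "u - y \<in> tensor_class s n x" by (simp add: tensor_class_def algebra_simps)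
  then show "u \<in> tensor_class s n x \<oplus>\<^sub>t tensor_class s n y"
    unfolding tensor_add_def using tensor_class_self[of y s n] by force
qed

lemma tensor_class_diff: "tensor_class s n x \<ominus>\<^sub>t tensor_class s n y = tensor_class s n (x - y)"
proof (intro set_eqI iffI)
  fix u assume "u \<in> tensor_class s n x \<ominus>\<^sub>t tensor_class s n y"
  then obtain v w where u: "u = v - w" and "v - x \<in> tensor_relations s n" "w - y \<in> tensor_relations s n"
    by (auto simp: tensor_diff_def tensor_class_def)
  then show "u \<in> tensor_class s n (x - y)"
    using tensor_relations.diff[of "v - x" s n "w - y"] by (simp add: u tensor_class_def algebra_simps)
next
  fix u assume "u \<in> tensor_class s n (x - y)"
  then have "u + y \<in> tensor_class s n x" by (simp add: tensor_class_def algebra_simps)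
  then show "u \<in> tensor_class s n x \<ominus>\<^sub>t tensor_class s n y"
    unfolding tensor_diff_def using tensor_class_self[of y s n] by force
qed

definition multilinear_into ::
    "('l::field \<Rightarrow> 'b::ab_group_add \<Rightarrow> 'b) \<Rightarrow> nat \<Rightarrow> ('k::field \<Rightarrow> 'a::ab_group_add \<Rightarrow> 'a) \<Rightarrow> nat \<Rightarrow>
     ('b list \<Rightarrow> 'a tensor) \<Rightarrow> bool" where
  "multilinear_into s' m s n \<phi> \<longleftrightarrow>
     (\<forall>w. length w = m \<longrightarrow> \<phi> w \<in> tensor_power s n) \<and>
     (\<forall>w i a b. length w = m \<longrightarrow> i < m \<longrightarrow> \<phi> (w[i := a + b]) = \<phi> (w[i := a]) \<oplus>\<^sub>t \<phi> (w[i := b])) \<and>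
     (\<forall>w i j c. length w = m \<longrightarrow> i < m \<longrightarrow> j < m \<longrightarrow> \<phi> (w[i := s' c (w ! i)]) = \<phi> (w[j := s' c (w ! j)]))"

lemma tensor_lift_class:
  assumes "multilinear_into s' m s n \<phi>"
  shows "tensor_lift s n \<phi> (tensor_class s' m x)
       = tensor_class s n (frag_extend (\<lambda>w. SOME y. y \<in> \<phi> w) x)"
proof -
  define f where "f = (\<lambda>w. SOME y. y \<in> \<phi> w)"
  have f: "\<phi> w = tensor_class s n (f w)" if w: "length w = m" for w
  proof -
    obtain y where y: "\<phi> w = tensor_class s n y"
      using assms w by (auto simp: multilinear_into_def tensor_power_def)
    have "f w \<in> \<phi> w"
      unfolding f_def using tensor_class_self[of y s n] y by (metis someI)
    then have "f w - y \<in> tensor_relations s n" using y by (simp add: tensor_class_def)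
    then show ?thesis using y by (simp add: tensor_class_eq_iff[symmetric])
  qed
  have rel: "frag_extend f u \<in> tensor_relations s n" if "u \<in> tensor_relations s' m" for u
    using that
  proof induction
    case zero
    then show ?case by (simp add: tensor_relations.zero)
  next
    case (diff x y)
    then show ?case by (simp add: frag_extend_diff tensor_relations.diff)
  next
    case (additive w i a b)
    then have "\<phi> (w[i := a + b]) = \<phi> (w[i := a]) \<oplus>\<^sub>t \<phi> (w[i := b])"
      using assms by (simp add: multilinear_into_def)
    then have "tensor_class s n (f (w[i := a + b])) = tensor_class s n (f (w[i := a]) + f (w[i := b]))"
      using additive by (simp add: f tensor_class_add)
    then have "f (w[i := a + b]) - f (w[i := a]) - f (w[i := b]) \<in> tensor_relations s n"
      by (simp only: tensor_class_eq_iff diff_diff_eq)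
    then show ?case
      unfolding frag_extend_diff frag_extend_of .
  next
    case (balanced w i j c)
    have "tensor_class s n (f (w[i := s' c (w ! i)])) = \<phi> (w[i := s' c (w ! i)])"
      by (rule f[symmetric]) (simp add: balanced(1))
    also have "\<dots> = \<phi> (w[j := s' c (w ! j)])"
      using assms balanced unfolding multilinear_into_def by blast
    also have "\<dots> = tensor_class s n (f (w[j := s' c (w ! j)]))"
      by (rule f) (simp add: balanced(1))
    finally show ?case
      unfolding tensor_class_eq_iff frag_extend_diff frag_extend_of .
  qed
  have "tensor_class s n (frag_extend f u) = tensor_class s n (frag_extend f x)"
    if "u \<in> tensor_class s' m x" for u
    using rel[of "u - x"] that by (simp add: tensor_class_def[of s'] tensor_class_eq_iff frag_extend_diff)
  then show ?thesis
    unfolding tensor_lift_def f_def[symmetric] using tensor_class_self[of x s' m] by blast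
qed

lemma tensor_lift_pure:
  assumes "multilinear_into s' (length w) s n \<phi>"
  shows "tensor_lift s n \<phi> (pure s' w) = \<phi> w"
proof -
  obtain y where y: "\<phi> w = tensor_class s n y"
    using assms by (auto simp: multilinear_into_def tensor_power_def)
  have "(SOME u. u \<in> \<phi> w) \<in> \<phi> w"
    using tensor_class_self[of y s n] y by (metis someI)
  then show ?thesis
    unfolding pure_def tensor_lift_class[OF assms] using y
    by (simp add: tensor_class_eq_iff) (simp add: tensor_class_def)
qed

lemma tensor_lift_add:
  assumes "multilinear_into s' m s n \<phi>" "X \<in> tensor_power s' m" "Y \<in> tensor_power s' m"
  shows "tensor_lift s n \<phi> (X \<oplus>\<^sub>t Y) = tensor_lift s n \<phi> X \<oplus>\<^sub>t tensor_lift s n \<phi> Y"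
  using assms(2,3)
  by (auto simp: tensor_power_def tensor_class_add tensor_lift_class[OF assms(1)] frag_extend_add)

lemma (in ore_extension) ore_extension_universal:
  fixes scaleB :: "'k \<Rightarrow> 'b::ring_1 \<Rightarrow> 'b"
  assumes B: "k_algebra scaleB" and f: "algebra_hom scaleA scaleB f"
    and fb: "\<And>a. b * f a = f (\<tau> a) * b + f (\<delta> a)"
  shows "\<exists>!F. algebra_hom scaleH scaleB F \<and> (\<forall>a. F (\<iota> a) = f a) \<and> F z = b"
proof -
  interpret B: k_algebra scaleB by (fact B)
  interpret io: Vector_Spaces.linear scaleA scaleH \<iota>
    using iota_hom by (simp add: algebra_hom_def)
  interpret fl: Vector_Spaces.linear scaleA scaleB f
    using f by (simp add: algebra_hom_def)
  have io1: "\<iota> 1 = 1" "\<And>x y. \<iota> (x * y) = \<iota> x * \<iota> y"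
    using iota_hom by (auto simp: algebra_hom_def)
  have f1: "f 1 = 1" "\<And>x y. f (x * y) = f x * f y"
    using f by (auto simp: algebra_hom_def)
  define P where "P = (\<lambda>p :: 'a poly. \<Sum>i\<le>degree p. \<iota> (poly.coeff p i) * z ^ i)"
  define Q where "Q = (\<lambda>p :: 'a poly. \<Sum>i\<le>degree p. f (poly.coeff p i) * b ^ i)"
  have bijP: "bij P" using ore_basis by (simp add: P_def)
  have P_n: "P p = (\<Sum>i\<le>n. \<iota> (poly.coeff p i) * z ^ i)" if "degree p \<le> n" for p n
    unfolding P_def using that
    by (intro sum.mono_neutral_left) (auto simp: coeff_eq_0 io.zero)
  have Q_n: "Q p = (\<Sum>i\<le>n. f (poly.coeff p i) * b ^ i)" if "degree p \<le> n" for p n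
    unfolding Q_def using that
    by (intro sum.mono_neutral_left) (auto simp: coeff_eq_0 fl.zero)
  have P_add: "P (p + q) = P p + P q" for p q
    using P_n[of p "max (degree p) (degree q)"] P_n[of q "max (degree p) (degree q)"]
      P_n[of "p + q" "max (degree p) (degree q)"]
    by (simp add: degree_add_le_max io.add algebra_simps sum.distrib)
  have Q_add: "Q (p + q) = Q p + Q q" for p q
    using Q_n[of p "max (degree p) (degree q)"] Q_n[of q "max (degree p) (degree q)"]
      Q_n[of "p + q" "max (degree p) (degree q)"]
    by (simp add: degree_add_le_max fl.add algebra_simps sum.distrib)
  have P_monom: "P (monom a i) = \<iota> a * z ^ i" for a i
  proof -
    have "P (monom a i) = (\<Sum>j\<le>i. \<iota> (poly.coeff (monom a i) j) * z ^ j)"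
      by (rule P_n) (rule degree_monom_le)
    also have "\<dots> = (\<Sum>j\<le>i. if j = i then \<iota> a * z ^ i else 0)"
      by (rule sum.cong) (auto simp: io.zero)
    finally show ?thesis by simp
  qed
  have Q_monom: "Q (monom a i) = f a * b ^ i" for a i
  proof -
    have "Q (monom a i) = (\<Sum>j\<le>i. f (poly.coeff (monom a i) j) * b ^ j)"
      by (rule Q_n) (rule degree_monom_le)
    also have "\<dots> = (\<Sum>j\<le>i. if j = i then f a * b ^ i else 0)"
      by (rule sum.cong) (auto simp: fl.zero)
    finally show ?thesis by simp
  qed
  define F where "F = (\<lambda>h. Q (inv P h))"
  have FP: "F (P p) = Q p" for p
    using bijP by (simp add: F_def bij_is_inj)
  have obtP: "\<exists>p. h = P p" for h
    using bijP by (metis bij_pointE)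
  have F_add: "F (x + y) = F x + F y" for x y
    by (metis obtP P_add Q_add FP)
  have F_monom: "F (\<iota> a * z ^ i) = f a * b ^ i" for a i
    by (metis P_monom Q_monom FP)
  have F_0: "F 0 = 0" using F_add[of 0 0] by simp
  have F_iota: "F (\<iota> a) = f a" for a using F_monom[of a 0] by simp
  have F_z: "F z = b" using F_monom[of 1 1] by (simp add: io1 f1)
  have span: "R h" if "R 0" "\<And>x y. R x \<Longrightarrow> R y \<Longrightarrow> R (x + y)" "\<And>a i. R (\<iota> a * z ^ i)"
    for R :: "'h \<Rightarrow> bool" and h
  proof -
    have "R (\<Sum>i\<in>I. \<iota> (c i) * z ^ i)" if "finite I" for I c
      using that by (induction I rule: finite_induct) (auto intro: \<open>R 0\<close> that \<open>\<And>x y. R x \<Longrightarrow> R y \<Longrightarrow> R (x + y)\<close> \<open>\<And>a i. R (\<iota> a * z ^ i)\<close>)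
    then show ?thesis using obtP[of h] by (auto simp: P_def)
  qed
  have F_left: "F (\<iota> a * h) = f a * F h" for a h
  proof (rule span[of "\<lambda>h. F (\<iota> a * h) = f a * F h"])
    fix a' i
    show "F (\<iota> a * (\<iota> a' * z ^ i)) = f a * F (\<iota> a' * z ^ i)"
      using F_monom[of "a * a'" i] by (simp add: F_monom io1 f1 mult.assoc)
  qed (auto simp: F_0 F_add algebra_simps)
  have F_zleft: "F (z * h) = b * F h" for h
  proof (rule span[of "\<lambda>h. F (z * h) = b * F h"])
    fix a i
    have "z * (\<iota> a * z ^ i) = (z * \<iota> a) * z ^ i" by (simp add: mult.assoc)
    also have "\<dots> = \<iota> (\<tau> a) * z ^ Suc i + \<iota> (\<delta> a) * z ^ i"
      by (simp add: ore_relation distrib_right mult.assoc)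
    finally have "F (z * (\<iota> a * z ^ i)) = f (\<tau> a) * b ^ Suc i + f (\<delta> a) * b ^ i"
      by (simp only: F_add F_monom)
    also have "\<dots> = (b * f a) * b ^ i"
      by (simp add: fb distrib_right mult.assoc)
    finally show "F (z * (\<iota> a * z ^ i)) = b * F (\<iota> a * z ^ i)"
      by (simp add: F_monom mult.assoc)
  qed (auto simp: F_0 F_add algebra_simps)
  have F_zpow: "F (z ^ i * h) = b ^ i * F h" for i h
    by (induction i arbitrary: h) (simp_all add: F_zleft mult.assoc)
  have F_zi: "F (z ^ i) = b ^ i" for i
    using F_monom[of 1 i] by (simp only: io1 f1 mult_1_left)
  have F_mult: "F (x * y) = F x * F y" for x y
  proof (rule span[of "\<lambda>x. F (x * y) = F x * F y"])
    fix a i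
    show "F (\<iota> a * z ^ i * y) = F (\<iota> a * z ^ i) * F y"
      by (simp only: mult.assoc F_left F_zpow F_zi)
  qed (simp_all add: F_0 F_add distrib_right)
  have F_scale: "F (scaleH c x) = scaleB c (F x)" for c x
  proof -
    have "scaleH c x = \<iota> (scaleA c 1) * x"
      by (simp add: io.scale io1 H.scale_mult_left)
    then show ?thesis
      by (simp add: F_left fl.scale f1 B.scale_mult_left)
  qed
  have "algebra_hom scaleH scaleB F"
    unfolding algebra_hom_def
    using F_iota[of 1] F_mult F_add F_scale
    by (auto simp: io1 f1 Vector_Spaces.linear_iff H.vector_space_axioms B.vector_space_axioms)
  moreover have "G = F"
    if G: "algebra_hom scaleH scaleB G" "\<forall>a. G (\<iota> a) = f a" "G z = b" for G
  proof
    fix h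
    interpret Gl: Vector_Spaces.linear scaleH scaleB G
      using G(1) by (simp add: algebra_hom_def)
    have G1: "G 1 = 1" "\<And>x y. G (x * y) = G x * G y"
      using G(1) by (auto simp: algebra_hom_def)
    have Gp: "G (z ^ i) = b ^ i" for i
      by (induction i) (simp_all add: G1 G(3))
    show "G h = F h"
      by (rule span[of "\<lambda>h. G h = F h"]) (auto simp: F_0 F_add F_monom Gl.zero Gl.add G1 Gp G(2))
  qed
  ultimately show ?thesis using F_iota F_z by blast
qed

end

theory Submission
  imports Defs
begin

text \<open>
  By the universal property of \<open>H\<close>, the map \<open>\<mu>\<close> extends to an algebra map on \<open>H\<close> with the prescribed
  value at \<open>z\<close> iff \<open>\<mu> z \<mu> a = \<mu> (\<tau> a) \<mu> z + \<mu> (\<delta> a)\<close> in \<open>H \<otimes> H\<^sup>o\<^sup>p \<otimes> H\<close> for all \<open>a\<close>.  As \<open>H\<close> is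
  free over \<open>A\<close> on the powers of \<open>z\<close>, this equation can be compared coefficientwise: the coefficients of
  \<open>z \<otimes> 1 \<otimes> 1\<close>, \<open>1 \<otimes> z \<otimes> 1\<close>, \<open>1 \<otimes> 1 \<otimes> z\<close> and \<open>1 \<otimes> 1 \<otimes> 1\<close> give four identities that are together
  equivalent to (1), (2) and (3).  Once the algebra map exists, coassociativity and the two unit laws hold
  automatically: they are stable under products, so they need only be checked on \<open>A\<close> and at \<open>z\<close>.
\<close>

section \<open>Tensor powers\<close>

text \<open>Tensors are cosets in a carrier set, not elements of a type of class
  \<open>ring_1\<close>, so \<open>ore_extension_universal\<close> cannot be applied with target H
  \<otimes> H^op \<otimes> H. The algebra map is instead built on normal forms, and its
  multiplicativity is proved by induction on them. The comparison of coefficients uses no basis of a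
  tensor power: each coefficient of a normal form is a k-linear map from H to A, and three of these
  applied factorwise turn an equation over H into one over A. The opposite middle factor shapes
  condition (3). In \<mu>(z)\<mu>(a) the middle z lands to the right of a_(2), in normal form; in
  \<mu>(\<tau> a)\<mu>(z) it lands to the left and must be commuted, which creates a middle
  \<delta>. Condition (2) then trades \<tau> for conjugation by g, and this is where \<tau>^{-1}
  comes from. The third term of \<mu>(z) is the correction that the unit laws demand: m \<otimes> id
  makes it cancel the first term, id \<otimes> m the second.\<close>

lemma tensor_class_in_tensor_power:
  "(\<And>w. w \<in> Poly_Mapping.keys x \<Longrightarrow> length w = n) \<Longrightarrow> tensor_class s n x \<in> tensor_power s n"
  by (auto simp: tensor_power_def)

lemma pure_in_tensor_power [simp]: "length w = n \<Longrightarrow> pure s w \<in> tensor_power s n"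
  by (auto simp: pure_def intro: tensor_class_in_tensor_power)

lemma tensor_add_in_tensor_power [simp]:
  assumes "X \<in> tensor_power s n" "Y \<in> tensor_power s n"
  shows "X \<oplus>\<^sub>t Y \<in> tensor_power s n"
proof -
  obtain x y where x: "X = tensor_class s n x" "\<forall>w\<in>Poly_Mapping.keys x. length w = n"
    and y: "Y = tensor_class s n y" "\<forall>w\<in>Poly_Mapping.keys y. length w = n"
    using assms by (auto simp: tensor_power_def)
  show ?thesis
    unfolding x(1) y(1) tensor_class_add
    by (rule tensor_class_in_tensor_power) (use x(2) y(2) Poly_Mapping.keys_add[of x y] in blast)
qed

text \<open>Commutativity and associativity hold for sums of arbitrary sets, so sums can be
  rearranged without membership conditions; the zero law is the one that asks for
  membership.\<close>

lemma tensor_add_commute: "X \<oplus>\<^sub>t Y = Y \<oplus>\<^sub>t X"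
  unfolding tensor_add_def by (auto intro: add.commute)

lemma tensor_add_assoc: "(X \<oplus>\<^sub>t Y) \<oplus>\<^sub>t W = X \<oplus>\<^sub>t (Y \<oplus>\<^sub>t W)"
proof (intro set_eqI iffI)
  fix u assume "u \<in> X \<oplus>\<^sub>t Y \<oplus>\<^sub>t W"
  then obtain x y w where "u = (x + y) + w" "x \<in> X" "y \<in> Y" "w \<in> W"
    unfolding tensor_add_def by blast
  then show "u \<in> X \<oplus>\<^sub>t (Y \<oplus>\<^sub>t W)"
    unfolding tensor_add_def add.assoc by blast
next
  fix u assume "u \<in> X \<oplus>\<^sub>t (Y \<oplus>\<^sub>t W)"
  then obtain x y w where "u = x + (y + w)" "x \<in> X" "y \<in> Y" "w \<in> W"
    unfolding tensor_add_def by blast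
  then show "u \<in> X \<oplus>\<^sub>t Y \<oplus>\<^sub>t W"
    unfolding tensor_add_def add.assoc[symmetric] by blast
qed

lemma tensor_add_left_commute: "X \<oplus>\<^sub>t (Y \<oplus>\<^sub>t W) = Y \<oplus>\<^sub>t (X \<oplus>\<^sub>t W)"
  by (metis tensor_add_assoc tensor_add_commute)

lemmas tensor_add_ac = tensor_add_assoc tensor_add_commute tensor_add_left_commute

definition tensor_zero :: "('k::field \<Rightarrow> 'a::ab_group_add \<Rightarrow> 'a) \<Rightarrow> nat \<Rightarrow> 'a tensor" where
  "tensor_zero s n = tensor_class s n 0"

lemma tensor_zero_in_tensor_power [simp]: "tensor_zero s n \<in> tensor_power s n"
  by (auto simp: tensor_zero_def intro: tensor_class_in_tensor_power)

lemma tensor_add_zero [simp]: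
  assumes "X \<in> tensor_power s n"
  shows "X \<oplus>\<^sub>t tensor_zero s n = X" "tensor_zero s n \<oplus>\<^sub>t X = X"
  using assms by (auto simp: tensor_power_def tensor_zero_def tensor_class_add)

section \<open>Sums, scalars, zeros and signs inside pure tensors\<close>

lemma pure_update_add:
  assumes "i < length w"
  shows "pure s (w[i := a + b]) = pure s (w[i := a]) \<oplus>\<^sub>t pure s (w[i := b])"
proof -
  have "frag_of (w[i := a + b]) - (frag_of (w[i := a]) + frag_of (w[i := b]))
      \<in> tensor_relations s (length w)"
    using tensor_relations.additive[of w "length w" i a b s] assms by (simp add: diff_diff_eq)
  then show ?thesis
    by (simp add: pure_def tensor_class_add tensor_class_eq_iff)
qed

lemma pure_update_scale:
  "i < length w \<Longrightarrow> j < length w \<Longrightarrow> pure s (w[i := s c (w ! i)]) = pure s (w[j := s c (w ! j)])"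
  using tensor_relations.balanced[of w "length w" i j s c]
  by (simp add: pure_def tensor_class_eq_iff)

lemma pure_add_nth:
  "pure s ((a + b) # vs) = pure s (a # vs) \<oplus>\<^sub>t pure s (b # vs)"
  "pure s (p # (a + b) # vs) = pure s (p # a # vs) \<oplus>\<^sub>t pure s (p # b # vs)"
  "pure s (p # q # (a + b) # vs) = pure s (p # q # a # vs) \<oplus>\<^sub>t pure s (p # q # b # vs)"
  "pure s (p # q # r # (a + b) # vs) = pure s (p # q # r # a # vs) \<oplus>\<^sub>t pure s (p # q # r # b # vs)"
  "pure s (p # q # r # t # (a + b) # vs)
    = pure s (p # q # r # t # a # vs) \<oplus>\<^sub>t pure s (p # q # r # t # b # vs)"
  using pure_update_add[of 0 "a # vs" s a b] pure_update_add[of 1 "p # a # vs" s a b]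
    pure_update_add[of 2 "p # q # a # vs" s a b] pure_update_add[of 3 "p # q # r # a # vs" s a b]
    pure_update_add[of 4 "p # q # r # t # a # vs" s a b]
  by (simp_all add: eval_nat_numeral)

text \<open>Oriented so that rewriting collects every scalar in the first factor.\<close>

lemma pure_scale_nth:
  "pure s (p # s c a # vs) = pure s (s c p # a # vs)"
  "pure s (p # q # s c a # vs) = pure s (s c p # q # a # vs)"
  "pure s (p # q # r # s c a # vs) = pure s (s c p # q # r # a # vs)"
  "pure s (p # q # r # t # s c a # vs) = pure s (s c p # q # r # t # a # vs)"
  using pure_update_scale[of 1 "p # a # vs" 0 s c]
    pure_update_scale[of 2 "p # q # a # vs" 0 s c] pure_update_scale[of 3 "p # q # r # a # vs" 0 s c]
    pure_update_scale[of 4 "p # q # r # t # a # vs" 0 s c]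
  by (simp_all add: eval_nat_numeral)

text \<open>The additivity relation for 0 + 0 is just \<open>- frag_of (w[i := 0])\<close>.\<close>

lemma pure_update_zero:
  assumes "i < length w"
  shows "pure s (w[i := 0]) = tensor_zero s (length w)"
  using tensor_relations.additive[of w "length w" i 0 0 s] assms
    tensor_relations_uminus[of "- frag_of (w[i := 0])" s "length w"]
  by (simp add: pure_def tensor_zero_def tensor_class_eq_iff)

lemma pure_zero_nth:
  "pure s (0 # vs) = tensor_zero s (Suc (length vs))"
  "pure s (p # 0 # vs) = tensor_zero s (Suc (Suc (length vs)))"
  "pure s (p # q # 0 # vs) = tensor_zero s (Suc (Suc (Suc (length vs))))"
  using pure_update_zero[of 0 "0 # vs" s] pure_update_zero[of 1 "p # 0 # vs" s]
    pure_update_zero[of 2 "p # q # 0 # vs" s]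
  by (simp_all add: eval_nat_numeral)

text \<open>A sign can be absorbed by the head factor, which lets \<open>tensor_diff_pure\<close>
  trade a difference for a sum.\<close>

lemma pure_uminus_hd:
  "pure s (- a # vs) = tensor_class s (Suc (length vs)) (- frag_of (a # vs))"
proof -
  have "tensor_zero s (Suc (length vs)) = pure s (- a # vs) \<oplus>\<^sub>t pure s (a # vs)"
    by (simp flip: pure_add_nth(1) add: pure_zero_nth)
  then have "- (frag_of (- a # vs) + frag_of (a # vs)) \<in> tensor_relations s (Suc (length vs))"
    by (simp add: pure_def tensor_zero_def tensor_class_add tensor_class_eq_iff)
  from tensor_relations_uminus[OF this] show ?thesis
    by (simp add: pure_def tensor_class_eq_iff add.commute)
qed

lemma tensor_diff_pure:
  assumes "X \<in> tensor_power s (Suc (length vs))"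
  shows "X \<ominus>\<^sub>t pure s (a # vs) = X \<oplus>\<^sub>t pure s (- a # vs)"
proof -
  obtain x where "X = tensor_class s (Suc (length vs)) x"
    using assms by (auto simp: tensor_power_def)
  then show ?thesis
    unfolding pure_uminus_hd by (simp add: tensor_class_add) (simp add: pure_def tensor_class_diff)
qed

text \<open>A representative is an integer combination of lists, and negative coefficients move into
  the head factor, so pure tensors generate under addition alone. \<open>0 < n\<close> guarantees
  that there is a head factor.\<close>

lemma tensor_power_induct [consumes 2, case_names pure add]:
  assumes "X \<in> tensor_power s n" "0 < n"
    and pure: "\<And>w. length w = n \<Longrightarrow> P (pure s w)"
    and add: "\<And>X Y. X \<in> tensor_power s n \<Longrightarrow> Y \<in> tensor_power s n \<Longrightarrow> P X \<Longrightarrow> P Y \<Longrightarrow> P (X \<oplus>\<^sub>t Y)"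
  shows "P X"
proof -
  define Q where "Q X \<longleftrightarrow> X \<in> tensor_power s n \<and> P X" for X
  obtain x where x: "X = tensor_class s n x" "Poly_Mapping.keys x \<subseteq> {w. length w = n}"
    using assms(1) by (auto simp: tensor_power_def)
  \<comment> \<open>Carrying x and -x together serves the difference case: a - b is the sum of a and
    -b.\<close>
  have "Q (tensor_class s n x) \<and> Q (tensor_class s n (- x))"
    using x(2)
  proof (induction x rule: frag_induction)
    case zero
    obtain m where n: "n = Suc m" using assms(2) by (cases n) auto
    have "tensor_class s n 0 = pure s (replicate n 0)"
      by (simp add: n pure_zero_nth(1) tensor_zero_def)
    then show ?case using pure[of "replicate n 0"] by (simp add: Q_def)
  next
    case (one w)
    then obtain a vs where w: "w = a # vs" "length vs = n - 1" "length w = n"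
      using assms(2) by (cases w) auto
    have 1: "tensor_class s n (frag_of w) = pure s w"
      "tensor_class s n (- frag_of w) = pure s (- a # vs)"
      using w assms(2) by (simp_all add: pure_uminus_hd) (simp add: pure_def)
    have "length (- a # vs) = n" using w assms(2) by simp
    then show ?case using w pure[of w] pure[of "- a # vs"] unfolding 1 Q_def
      by (metis pure_in_tensor_power)
  next
    case (diff a b)
    have "tensor_class s n (a - b) = tensor_class s n a \<oplus>\<^sub>t tensor_class s n (- b)"
      "tensor_class s n (- (a - b)) = tensor_class s n (- a) \<oplus>\<^sub>t tensor_class s n b"
      by (simp_all add: tensor_class_add)
    with diff show ?case by (simp add: Q_def add)
  qed
  then show ?thesis by (simp add: x Q_def)
qed

lemma list3_cases:
  assumes "length w = 3" obtains x y v where "w = [x, y, v]"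
  using assms by (auto simp: eval_nat_numeral length_Suc_conv)

lemma tensor_power3_induct [consumes 1, case_names pure add]:
  assumes "X \<in> tensor_power s 3"
    and "\<And>x y w. P (pure s [x, y, w])"
    and "\<And>X Y. X \<in> tensor_power s 3 \<Longrightarrow> Y \<in> tensor_power s 3 \<Longrightarrow> P X \<Longrightarrow> P Y \<Longrightarrow> P (X \<oplus>\<^sub>t Y)"
  shows "P X"
  using assms(1) zero_less_numeral
proof (induction X rule: tensor_power_induct)
  case (pure w)
  then show ?case using assms(2) by (metis list3_cases)
qed (use assms(3) in auto)

section \<open>Induced maps and their dependence on parameters\<close>

lemma tensor_lift_in_tensor_power:
  assumes "multilinear_into s' m s n \<phi>" "X \<in> tensor_power s' m" "0 < m"
  shows "tensor_lift s n \<phi> X \<in> tensor_power s n"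
  using assms(2,3)
proof (induction X rule: tensor_power_induct)
  case (pure w)
  have "tensor_lift s n \<phi> (pure s' w) = \<phi> w"
    by (rule tensor_lift_pure) (simp add: pure assms(1))
  then show ?case
    using assms(1) pure by (simp add: multilinear_into_def)
next
  case (add X Y)
  then show ?case by (simp add: tensor_lift_add[OF assms(1)])
qed

lemma tensor_lift_plus:
  assumes "multilinear_into s' m s n \<phi>" "multilinear_into s' m s n \<psi>" "multilinear_into s' m s n \<theta>"
    and "\<And>w. length w = m \<Longrightarrow> \<theta> w = \<phi> w \<oplus>\<^sub>t \<psi> w" "X \<in> tensor_power s' m" "0 < m"
  shows "tensor_lift s n \<theta> X = tensor_lift s n \<phi> X \<oplus>\<^sub>t tensor_lift s n \<psi> X"
  using assms(5,6)
proof (induction X rule: tensor_power_induct)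
  case (pure w)
  then show ?case using assms(1-4) by (simp add: tensor_lift_pure)
next
  case (add X Y)
  then show ?case using assms(1-3) by (simp add: tensor_lift_add tensor_add_ac)
qed

lemma tensor_lift_cong:
  assumes "multilinear_into s' m s n \<phi>" "multilinear_into s' m s n \<psi>"
    and "\<And>w. length w = m \<Longrightarrow> \<phi> w = \<psi> w" "X \<in> tensor_power s' m" "0 < m"
  shows "tensor_lift s n \<phi> X = tensor_lift s n \<psi> X"
  using assms(4,5)
proof (induction X rule: tensor_power_induct)
  case (pure w)
  then show ?case using assms(1-3) by (simp add: tensor_lift_pure)
next
  case (add X Y)
  then show ?case using assms(1,2) by (simp add: tensor_lift_add)
qed

text \<open>Makes iterated lifts well defined: the value of an inner lift is additive and balanced
  in the outer arguments, because a lift depends additively on the lifted map and only on its values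
  at lists of the right length. Products of tensors are such iterated lifts.\<close>

lemma multilinear_into_lift_param:
  fixes \<Phi> :: "'b::ab_group_add list \<Rightarrow> 'c::ab_group_add list \<Rightarrow> 'a::ab_group_add tensor"
  assumes 1: "\<And>w. length w = m \<Longrightarrow> multilinear_into s' l s n (\<Phi> w)"
    and 2: "\<And>v. length v = l \<Longrightarrow> multilinear_into s'' m s n (\<lambda>w. \<Phi> w v)"
    and Y: "Y \<in> tensor_power s' l" "0 < l"
  shows "multilinear_into s'' m s n (\<lambda>w. tensor_lift s n (\<Phi> w) Y)"
  unfolding multilinear_into_def
proof (intro conjI allI impI)
  fix w :: "'b list" assume w: "length w = m"
  show "tensor_lift s n (\<Phi> w) Y \<in> tensor_power s n"
    by (rule tensor_lift_in_tensor_power[OF 1[OF w] Y])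
next
  fix w :: "'b list" and i a b assume w: "length w = m" "i < m"
  show "tensor_lift s n (\<Phi> (w[i := a + b])) Y
      = tensor_lift s n (\<Phi> (w[i := a])) Y \<oplus>\<^sub>t tensor_lift s n (\<Phi> (w[i := b])) Y"
  proof (rule tensor_lift_plus[OF 1 1 1 _ Y])
    fix v :: "'c list" assume "length v = l"
    from 2[OF this] w show "\<Phi> (w[i := a + b]) v = \<Phi> (w[i := a]) v \<oplus>\<^sub>t \<Phi> (w[i := b]) v"
      by (auto simp: multilinear_into_def)
  qed (simp_all add: w)
next
  fix w :: "'b list" and i j c assume w: "length w = m" "i < m" "j < m"
  show "tensor_lift s n (\<Phi> (w[i := s'' c (w ! i)])) Y = tensor_lift s n (\<Phi> (w[j := s'' c (w ! j)])) Y"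
  proof (rule tensor_lift_cong[OF 1 1 _ Y])
    fix v :: "'c list" assume "length v = l"
    from 2[OF this] w show "\<Phi> (w[i := s'' c (w ! i)]) v = \<Phi> (w[j := s'' c (w ! j)]) v"
      unfolding multilinear_into_def by blast
  qed (simp_all add: w)
qed

lemma multilinear_into_pure_map:
  fixes s' :: "'k::field \<Rightarrow> 'b::ab_group_add \<Rightarrow> 'b" and s :: "'k \<Rightarrow> 'a::ab_group_add \<Rightarrow> 'a"
  assumes lin: "\<And>i. i < n \<Longrightarrow> Vector_Spaces.linear s' s (f i)"
  shows "multilinear_into s' n s n (\<lambda>w. pure s (map (\<lambda>i. f i (w ! i)) [0..<n]))"
proof -
  have upd: "map (\<lambda>i. f i (w[j := a] ! i)) [0..<n] = (map (\<lambda>i. f i (w ! i)) [0..<n])[j := f j a]"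
    if "length w = n" "j < n" for w j a
    using that by (intro nth_equalityI) (auto simp: nth_list_update)
  have add: "f i (a + b) = f i a + f i b" and sc: "f i (s' c a) = s c (f i a)" if "i < n" for i a b c
    using lin[OF that] by (simp_all add: Vector_Spaces.linear_iff)
  show ?thesis
    unfolding multilinear_into_def
  proof (intro conjI allI impI)
    fix w :: "'b list" and i j c assume w: "length w = n" "i < n" "j < n"
    show "pure s (map (\<lambda>ia. f ia (w[i := s' c (w ! i)] ! ia)) [0..<n])
        = pure s (map (\<lambda>i. f i (w[j := s' c (w ! j)] ! i)) [0..<n])"
      using pure_update_scale[of i "map (\<lambda>i. f i (w ! i)) [0..<n]" j s c] w
      by (simp add: upd sc)
  next
    fix w :: "'b list" and i a b assume w: "length w = n" "i < n"
    show "pure s (map (\<lambda>ia. f ia (w[i := a + b] ! ia)) [0..<n])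
        = pure s (map (\<lambda>ia. f ia (w[i := a] ! ia)) [0..<n])
          \<oplus>\<^sub>t pure s (map (\<lambda>ia. f ia (w[i := b] ! ia)) [0..<n])"
      unfolding upd[OF w] add[OF w(2)] by (rule pure_update_add) (simp add: w)
  qed simp
qed

section \<open>Trilinear maps and tensor products of three linear maps\<close>

definition trilinear_into ::
    "('k::field \<Rightarrow> 'b::ab_group_add \<Rightarrow> 'b) \<Rightarrow> ('k \<Rightarrow> 'a::ab_group_add \<Rightarrow> 'a) \<Rightarrow> nat \<Rightarrow>
     ('b \<Rightarrow> 'b \<Rightarrow> 'b \<Rightarrow> 'a tensor) \<Rightarrow> bool" where
  "trilinear_into s' s n \<phi> \<longleftrightarrow> multilinear_into s' 3 s n (\<lambda>w. \<phi> (w ! 0) (w ! 1) (w ! 2))"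

lemma less_3_cases:
  assumes "(i::nat) < 3" obtains "i = 0" | "i = 1" | "i = 2"
  using assms by linarith

lemma trilinear_intoI:
  fixes \<phi> :: "'a::ab_group_add \<Rightarrow> 'a \<Rightarrow> 'a \<Rightarrow> 'b::ab_group_add tensor"
  assumes closed: "\<And>x y w. \<phi> x y w \<in> tensor_power s n"
    and add: "\<And>x x' y w. \<phi> (x + x') y w = \<phi> x y w \<oplus>\<^sub>t \<phi> x' y w"
      "\<And>x y y' w. \<phi> x (y + y') w = \<phi> x y w \<oplus>\<^sub>t \<phi> x y' w"
      "\<And>x y w w'. \<phi> x y (w + w') = \<phi> x y w \<oplus>\<^sub>t \<phi> x y w'"
    and scale: "\<And>c x y w. \<phi> x (s' c y) w = \<phi> (s' c x) y w"
      "\<And>c x y w. \<phi> x y (s' c w) = \<phi> (s' c x) y w"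
  shows "trilinear_into s' s n \<phi>"
  unfolding trilinear_into_def multilinear_into_def
proof (intro conjI allI impI)
  fix w :: "'a list" and i :: nat and a b assume "length w = 3" "i < 3"
  then show "\<phi> (w[i := a + b] ! 0) (w[i := a + b] ! 1) (w[i := a + b] ! 2)
      = \<phi> (w[i := a] ! 0) (w[i := a] ! 1) (w[i := a] ! 2)
        \<oplus>\<^sub>t \<phi> (w[i := b] ! 0) (w[i := b] ! 1) (w[i := b] ! 2)"
    by (elim less_3_cases) (simp_all add: add)
next
  fix w :: "'a list" and i j :: nat and c assume w: "length w = 3" "i < 3" "j < 3"
  \<comment> \<open>Every position is compared with the first one, so balancing against the first
    argument is enough.\<close>
  have "\<phi> (w[i := s' c (w ! i)] ! 0) (w[i := s' c (w ! i)] ! 1) (w[i := s' c (w ! i)] ! 2)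
      = \<phi> (s' c (w ! 0)) (w ! 1) (w ! 2)" if "i < 3" for i :: nat
    using w(1) that by (elim less_3_cases) (simp_all add: scale)
  then show "\<phi> (w[i := s' c (w ! i)] ! 0) (w[i := s' c (w ! i)] ! 1) (w[i := s' c (w ! i)] ! 2)
      = \<phi> (w[j := s' c (w ! j)] ! 0) (w[j := s' c (w ! j)] ! 1) (w[j := s' c (w ! j)] ! 2)"
    using w(2,3) by simp
qed (rule closed)

lemma trilinear_intoD:
  assumes "trilinear_into s' s n \<phi>"
  shows "\<phi> x y w \<in> tensor_power s n"
    "\<phi> (x + x') y w = \<phi> x y w \<oplus>\<^sub>t \<phi> x' y w"
    "\<phi> x (y + y') w = \<phi> x y w \<oplus>\<^sub>t \<phi> x y' w"
    "\<phi> x y (w + w') = \<phi> x y w \<oplus>\<^sub>t \<phi> x y w'"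
    "\<phi> x (s' c y) w = \<phi> (s' c x) y w"
    "\<phi> x y (s' c w) = \<phi> (s' c x) y w"
proof -
  have cl: "length v = 3 \<Longrightarrow> \<phi> (v ! 0) (v ! 1) (v ! 2) \<in> tensor_power s n"
    and ad: "length v = 3 \<Longrightarrow> i < 3 \<Longrightarrow> \<phi> (v[i := a + b] ! 0) (v[i := a + b] ! 1) (v[i := a + b] ! 2)
      = \<phi> (v[i := a] ! 0) (v[i := a] ! 1) (v[i := a] ! 2)
        \<oplus>\<^sub>t \<phi> (v[i := b] ! 0) (v[i := b] ! 1) (v[i := b] ! 2)"
    and sc: "length v = 3 \<Longrightarrow> i < 3 \<Longrightarrow> j < 3 \<Longrightarrow>
      \<phi> (v[i := s' c (v ! i)] ! 0) (v[i := s' c (v ! i)] ! 1) (v[i := s' c (v ! i)] ! 2)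
      = \<phi> (v[j := s' c (v ! j)] ! 0) (v[j := s' c (v ! j)] ! 1) (v[j := s' c (v ! j)] ! 2)"
    for v and i j :: nat and a b c
    using assms unfolding trilinear_into_def multilinear_into_def by blast+
  show "\<phi> x y w \<in> tensor_power s n" using cl[of "[x, y, w]"] by simp
  show "\<phi> (x + x') y w = \<phi> x y w \<oplus>\<^sub>t \<phi> x' y w" using ad[of "[x, y, w]" 0 x x'] by simp
  show "\<phi> x (y + y') w = \<phi> x y w \<oplus>\<^sub>t \<phi> x y' w" using ad[of "[x, y, w]" 1 y y'] by simp
  show "\<phi> x y (w + w') = \<phi> x y w \<oplus>\<^sub>t \<phi> x y w'" using ad[of "[x, y, w]" 2 w w'] by simp
  show "\<phi> x (s' c y) w = \<phi> (s' c x) y w" using sc[of "[x, y, w]" 1 0 c] by simp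
  show "\<phi> x y (s' c w) = \<phi> (s' c x) y w" using sc[of "[x, y, w]" 2 0 c] by simp
qed

lemma tensor_lift3_pure:
  "trilinear_into s' s n \<phi> \<Longrightarrow> tensor_lift3 s n \<phi> (pure s' [x, y, w]) = \<phi> x y w"
  unfolding tensor_lift3_def trilinear_into_def by (subst tensor_lift_pure) (simp_all add: numeral_3_eq_3)

lemma tensor_lift3_add:
  "trilinear_into s' s n \<phi> \<Longrightarrow> X \<in> tensor_power s' 3 \<Longrightarrow> Y \<in> tensor_power s' 3 \<Longrightarrow>
    tensor_lift3 s n \<phi> (X \<oplus>\<^sub>t Y) = tensor_lift3 s n \<phi> X \<oplus>\<^sub>t tensor_lift3 s n \<phi> Y"
  unfolding tensor_lift3_def trilinear_into_def by (rule tensor_lift_add)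

lemma tensor_lift3_in_tensor_power:
  "trilinear_into s' s n \<phi> \<Longrightarrow> X \<in> tensor_power s' 3 \<Longrightarrow> tensor_lift3 s n \<phi> X \<in> tensor_power s n"
  unfolding tensor_lift3_def trilinear_into_def by (rule tensor_lift_in_tensor_power) auto

lemma tensor_lift3_plus:
  assumes "trilinear_into s' s n \<phi>" "trilinear_into s' s n \<psi>"
    and "trilinear_into s' s n (\<lambda>x y w. \<phi> x y w \<oplus>\<^sub>t \<psi> x y w)" "X \<in> tensor_power s' 3"
  shows "tensor_lift3 s n (\<lambda>x y w. \<phi> x y w \<oplus>\<^sub>t \<psi> x y w) X = tensor_lift3 s n \<phi> X \<oplus>\<^sub>t tensor_lift3 s n \<psi> X"
  using assms(4)
  by (induction rule: tensor_power3_induct)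
     (simp_all add: assms(1-3)[THEN tensor_lift3_pure] assms(1-3)[THEN tensor_lift3_add] tensor_add_ac)

lemma linear_map_add: "Vector_Spaces.linear s s' f \<Longrightarrow> f (x + y) = f x + f y"
  and linear_map_scale: "Vector_Spaces.linear s s' f \<Longrightarrow> f (s c x) = s' c (f x)"
  by (simp_all add: Vector_Spaces.linear_iff)

lemma trilinear_into_pure3:
  assumes "Vector_Spaces.linear s' s f" "Vector_Spaces.linear s' s g" "Vector_Spaces.linear s' s h"
  shows "trilinear_into s' s 3 (\<lambda>x y w. pure s [f x, g y, h w])"
  by (rule trilinear_intoI)
     (simp_all add: assms[THEN linear_map_add] assms[THEN linear_map_scale] pure_add_nth pure_scale_nth)

text \<open>All Sweedler expressions in conditions (1) to (3) have this form with X = \<mu> a, so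
  manipulating them amounts to composing linear maps factor by factor.\<close>

definition tensor_map3 ::
    "('k::field \<Rightarrow> 'a::ab_group_add \<Rightarrow> 'a) \<Rightarrow> ('b \<Rightarrow> 'a) \<Rightarrow> ('b \<Rightarrow> 'a) \<Rightarrow> ('b \<Rightarrow> 'a) \<Rightarrow> 'b tensor \<Rightarrow> 'a tensor" where
  "tensor_map3 s f g h X = tensor_lift3 s 3 (\<lambda>x y w. pure s [f x, g y, h w]) X"

context
  fixes s' :: "'k::field \<Rightarrow> 'b::ab_group_add \<Rightarrow> 'b" and s :: "'k \<Rightarrow> 'a::ab_group_add \<Rightarrow> 'a" and f g h
  assumes lin: "Vector_Spaces.linear s' s f" "Vector_Spaces.linear s' s g" "Vector_Spaces.linear s' s h"
begin

lemma tensor_map3_pure: "tensor_map3 s f g h (pure s' [x, y, w]) = pure s [f x, g y, h w]"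
  unfolding tensor_map3_def by (rule tensor_lift3_pure[OF trilinear_into_pure3[OF lin]])

lemma tensor_map3_add:
  "X \<in> tensor_power s' 3 \<Longrightarrow> Y \<in> tensor_power s' 3 \<Longrightarrow>
    tensor_map3 s f g h (X \<oplus>\<^sub>t Y) = tensor_map3 s f g h X \<oplus>\<^sub>t tensor_map3 s f g h Y"
  unfolding tensor_map3_def by (rule tensor_lift3_add[OF trilinear_into_pure3[OF lin]])

lemma tensor_map3_in_tensor_power:
  "X \<in> tensor_power s' 3 \<Longrightarrow> tensor_map3 s f g h X \<in> tensor_power s 3"
  unfolding tensor_map3_def by (rule tensor_lift3_in_tensor_power[OF trilinear_into_pure3[OF lin]])

end

lemma tensor_map3_id:
  assumes "vector_space s" "X \<in> tensor_power s 3"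
  shows "tensor_map3 s (\<lambda>x. x) (\<lambda>x. x) (\<lambda>x. x) X = X"
proof -
  interpret vector_space s by fact
  note id = linear_ident
  show ?thesis
    using assms(2)
    by (induction rule: tensor_power3_induct)
       (simp_all add: tensor_map3_pure[OF id id id] tensor_map3_add[OF id id id])
qed

lemma linear_compose_fun:
  "Vector_Spaces.linear s s' f \<Longrightarrow> Vector_Spaces.linear s' s'' g \<Longrightarrow> Vector_Spaces.linear s s'' (\<lambda>x. g (f x))"
  by (simp add: Vector_Spaces.linear_iff)

lemma tensor_map3_comp:
  assumes f: "Vector_Spaces.linear s' s f" "Vector_Spaces.linear s' s g" "Vector_Spaces.linear s' s h"
    and f': "Vector_Spaces.linear s s'' f'" "Vector_Spaces.linear s s'' g'" "Vector_Spaces.linear s s'' h'"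
    and X: "X \<in> tensor_power s' 3"
  shows "tensor_map3 s'' f' g' h' (tensor_map3 s f g h X)
       = tensor_map3 s'' (\<lambda>x. f' (f x)) (\<lambda>x. g' (g x)) (\<lambda>x. h' (h x)) X"
proof -
  note c = linear_compose_fun[OF f(1) f'(1)] linear_compose_fun[OF f(2) f'(2)] linear_compose_fun[OF f(3) f'(3)]
  show ?thesis
    using X
    by (induction rule: tensor_power3_induct)
       (simp_all add: tensor_map3_pure[OF f] tensor_map3_pure[OF f'] tensor_map3_pure[OF c]
         tensor_map3_add[OF f] tensor_map3_add[OF f'] tensor_map3_add[OF c] tensor_map3_in_tensor_power[OF f])
qed

lemma tensor_map3_plus:
  assumes "Vector_Spaces.linear s' s f" "Vector_Spaces.linear s' s f'"
    "Vector_Spaces.linear s' s g" "Vector_Spaces.linear s' s h" "X \<in> tensor_power s' 3"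
  shows "tensor_map3 s (\<lambda>x. f x + f' x) g h X = tensor_map3 s f g h X \<oplus>\<^sub>t tensor_map3 s f' g h X"
proof -
  have p: "Vector_Spaces.linear s' s (\<lambda>x. f x + f' x)"
    using assms(1,2) by (simp add: Vector_Spaces.linear_iff module.scale_right_distrib algebra_simps module_iff_vector_space)
  show ?thesis
    using assms(5)
    by (induction rule: tensor_power3_induct)
       (simp_all add: tensor_map3_pure[OF p assms(3,4)] tensor_map3_pure[OF assms(1,3,4)]
         tensor_map3_pure[OF assms(2,3,4)] tensor_map3_add[OF p assms(3,4)]
         tensor_map3_add[OF assms(1,3,4)] tensor_map3_add[OF assms(2,3,4)] pure_add_nth tensor_add_ac)
qed

lemma tensor_map3_zero:
  assumes "Vector_Spaces.linear s' s f" "Vector_Spaces.linear s' s g" "X \<in> tensor_power s' 3"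
  shows "tensor_map3 s (\<lambda>x. 0) f g X = tensor_zero s 3" (is ?A)
    and "tensor_map3 s f (\<lambda>x. 0) g X = tensor_zero s 3" (is ?B)
    and "tensor_map3 s f g (\<lambda>x. 0) X = tensor_zero s 3" (is ?C)
proof -
  have z: "Vector_Spaces.linear s' s (\<lambda>x. 0)"
    using assms(1) by (simp add: Vector_Spaces.linear_iff module.scale_zero_right module_iff_vector_space)
  show ?A ?B ?C
    using assms(3)
    by (induction rule: tensor_power3_induct)
       (simp_all add: tensor_map3_pure[OF z assms(1,2)] tensor_map3_pure[OF assms(1) z assms(2)]
         tensor_map3_pure[OF assms(1,2) z] tensor_map3_add[OF z assms(1,2)]
         tensor_map3_add[OF assms(1) z assms(2)] tensor_map3_add[OF assms(1,2) z]
         pure_zero_nth flip: numeral_3_eq_3)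
qed

section \<open>Multiplication of alternating tensor powers\<close>

context k_algebra
begin

lemma linear_mult_left: "Vector_Spaces.linear scale scale (\<lambda>x. a * x)"
  and linear_mult_right: "Vector_Spaces.linear scale scale (\<lambda>x. x * a)"
  by (simp_all add: Vector_Spaces.linear_iff vector_space_axioms algebra_simps
      scale_mult_left scale_mult_right)

end

text \<open>For \<open>n = 3\<close> and \<open>n = 5\<close> this is the multiplication of \<open>R \<otimes> R\<^sup>o\<^sup>p \<otimes> R\<close> and of
  \<open>R \<otimes> R\<^sup>o\<^sup>p \<otimes> R \<otimes> R\<^sup>o\<^sup>p \<otimes> R\<close> on pure tensors.\<close>

definition alternating_mult :: "nat \<Rightarrow> 'a::ring_1 list \<Rightarrow> 'a list \<Rightarrow> 'a list" where
  "alternating_mult n w v = map (\<lambda>i. if even i then w ! i * v ! i else v ! i * w ! i) [0..<n]"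

definition tensor_mult ::
    "('k::field \<Rightarrow> 'a::ring_1 \<Rightarrow> 'a) \<Rightarrow> nat \<Rightarrow> 'a tensor \<Rightarrow> 'a tensor \<Rightarrow> 'a tensor" where
  "tensor_mult s n X Y = tensor_lift s n (\<lambda>w. tensor_lift s n (\<lambda>v. pure s (alternating_mult n w v)) Y) X"

lemma tensor3_mult_eq: "tensor3_mult s X Y = tensor_mult s 3 X Y"
  by (simp add: tensor3_mult_def tensor_mult_def tensor_lift3_def alternating_mult_def eval_nat_numeral)

lemma length_alternating_mult [simp]: "length (alternating_mult n w v) = n"
  by (simp add: alternating_mult_def)

context k_algebra
begin

lemma multilinear_into_alternating_mult:
  "multilinear_into scale n scale n (\<lambda>v. pure scale (alternating_mult n w v))"
  "multilinear_into scale n scale n (\<lambda>w. pure scale (alternating_mult n w v))"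
proof -
  have "Vector_Spaces.linear scale scale (\<lambda>x. if even i then w ! i * x else x * w ! i)"
    and "Vector_Spaces.linear scale scale (\<lambda>x. if even i then x * v ! i else v ! i * x)" for i
    using linear_mult_left linear_mult_right by (cases "even i"; simp)+
  from this[THEN multilinear_into_pure_map]
  show "multilinear_into scale n scale n (\<lambda>v. pure scale (alternating_mult n w v))"
    "multilinear_into scale n scale n (\<lambda>w. pure scale (alternating_mult n w v))"
    unfolding alternating_mult_def .
qed

context
  fixes n :: nat
  assumes n: "0 < n"
begin

lemma multilinear_into_tensor_mult:
  assumes "Y \<in> tensor_power scale n"
  shows "multilinear_into scale n scale n (\<lambda>w. tensor_lift scale n (\<lambda>v. pure scale (alternating_mult n w v)) Y)"
  by (rule multilinear_into_lift_param[OF multilinear_into_alternating_mult assms n])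

lemma tensor_mult_in_tensor_power [simp]:
  "X \<in> tensor_power scale n \<Longrightarrow> Y \<in> tensor_power scale n \<Longrightarrow> tensor_mult scale n X Y \<in> tensor_power scale n"
  unfolding tensor_mult_def by (rule tensor_lift_in_tensor_power[OF multilinear_into_tensor_mult _ n])

lemma tensor_mult_pure_left:
  "length w = n \<Longrightarrow> Y \<in> tensor_power scale n \<Longrightarrow>
    tensor_mult scale n (pure scale w) Y = tensor_lift scale n (\<lambda>v. pure scale (alternating_mult n w v)) Y"
  unfolding tensor_mult_def by (rule tensor_lift_pure) (use multilinear_into_tensor_mult in simp)

lemma tensor_mult_pure:
  assumes "length w = n" "length v = n"
  shows "tensor_mult scale n (pure scale w) (pure scale v) = pure scale (alternating_mult n w v)"
  unfolding tensor_mult_pure_left[OF assms(1) pure_in_tensor_power[OF assms(2)]]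
  by (rule tensor_lift_pure) (use multilinear_into_alternating_mult(1)[of n w] assms in simp)

lemma tensor_mult_add_left:
  "X \<in> tensor_power scale n \<Longrightarrow> X' \<in> tensor_power scale n \<Longrightarrow> Y \<in> tensor_power scale n \<Longrightarrow>
    tensor_mult scale n (X \<oplus>\<^sub>t X') Y = tensor_mult scale n X Y \<oplus>\<^sub>t tensor_mult scale n X' Y"
  unfolding tensor_mult_def by (rule tensor_lift_add[OF multilinear_into_tensor_mult])

lemma tensor_mult_add_right:
  assumes "X \<in> tensor_power scale n" "Y \<in> tensor_power scale n" "Y' \<in> tensor_power scale n"
  shows "tensor_mult scale n X (Y \<oplus>\<^sub>t Y') = tensor_mult scale n X Y \<oplus>\<^sub>t tensor_mult scale n X Y'"
  using assms(1) n
proof (induction X rule: tensor_power_induct)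
  case (pure w)
  then show ?case
    using assms
    by (simp add: tensor_mult_pure_left tensor_lift_add[OF multilinear_into_alternating_mult(1)])
next
  case (add X X')
  then show ?case using assms by (simp add: tensor_mult_add_left tensor_add_ac)
qed

lemma tensor_mult_assoc:
  assumes "X \<in> tensor_power scale n" "Y \<in> tensor_power scale n" "W \<in> tensor_power scale n"
  shows "tensor_mult scale n (tensor_mult scale n X Y) W = tensor_mult scale n X (tensor_mult scale n Y W)"
  using assms(1) n
proof (induction X rule: tensor_power_induct)
  case x: (pure x)
  show ?case
    using assms(2) n
  proof (induction Y rule: tensor_power_induct)
    case y: (pure y)
    show ?case
      using assms(3) n
    proof (induction W rule: tensor_power_induct)
      case w: (pure w)
      have "alternating_mult n (alternating_mult n x y) w = alternating_mult n x (alternating_mult n y w)"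
        by (auto simp: alternating_mult_def mult.assoc)
      then show ?case using x y w by (simp add: tensor_mult_pure)
    qed (use x y in \<open>simp add: tensor_mult_add_right\<close>)
  qed (use x assms in \<open>simp add: tensor_mult_add_right tensor_mult_add_left\<close>)
qed (use assms in \<open>simp add: tensor_mult_add_left\<close>)

end

lemma tensor3_mult_in_tensor_power [simp]:
    "X \<in> tensor_power scale 3 \<Longrightarrow> Y \<in> tensor_power scale 3 \<Longrightarrow> tensor3_mult scale X Y \<in> tensor_power scale 3"
  and tensor3_mult_add_left:
    "X \<in> tensor_power scale 3 \<Longrightarrow> X' \<in> tensor_power scale 3 \<Longrightarrow> Y \<in> tensor_power scale 3 \<Longrightarrow>
      tensor3_mult scale (X \<oplus>\<^sub>t X') Y = tensor3_mult scale X Y \<oplus>\<^sub>t tensor3_mult scale X' Y"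
  and tensor3_mult_add_right:
    "X \<in> tensor_power scale 3 \<Longrightarrow> Y \<in> tensor_power scale 3 \<Longrightarrow> Y' \<in> tensor_power scale 3 \<Longrightarrow>
      tensor3_mult scale X (Y \<oplus>\<^sub>t Y') = tensor3_mult scale X Y \<oplus>\<^sub>t tensor3_mult scale X Y'"
  and tensor3_mult_assoc:
    "X \<in> tensor_power scale 3 \<Longrightarrow> Y \<in> tensor_power scale 3 \<Longrightarrow> W \<in> tensor_power scale 3 \<Longrightarrow>
      tensor3_mult scale (tensor3_mult scale X Y) W = tensor3_mult scale X (tensor3_mult scale Y W)"
  by (simp_all add: tensor3_mult_eq tensor_mult_add_left tensor_mult_add_right tensor_mult_assoc)

lemma tensor3_mult_pure:
  "tensor3_mult scale (pure scale [x, y, w]) (pure scale [x', y', w']) = pure scale [x * x', y' * y, w * w']"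
  by (simp add: tensor3_mult_eq tensor_mult_pure) (simp add: alternating_mult_def eval_nat_numeral)

lemma tensor5_mult_pure:
  "tensor_mult scale 5 (pure scale [a, b, c, d, e]) (pure scale [a', b', c', d', e'])
    = pure scale [a * a', b' * b, c * c', d' * d, e * e']"
  by (simp add: tensor_mult_pure) (simp add: alternating_mult_def upt_conv_Cons)

lemma tensor3_mult_zero:
  assumes "X \<in> tensor_power scale 3"
  shows "tensor3_mult scale (tensor_zero scale 3) X = tensor_zero scale 3"
    "tensor3_mult scale X (tensor_zero scale 3) = tensor_zero scale 3"
proof -
  have 0: "tensor_zero scale 3 = pure scale [0, 0, 0]"
    by (simp add: pure_zero_nth numeral_3_eq_3)
  show "tensor3_mult scale (tensor_zero scale 3) X = tensor_zero scale 3"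
    "tensor3_mult scale X (tensor_zero scale 3) = tensor_zero scale 3"
    using assms
    by (induction X rule: tensor_power3_induct)
       (simp_all add: 0 tensor3_mult_pure tensor3_mult_add_left tensor3_mult_add_right,
        simp_all flip: 0)
qed

lemma tensor3_mult_one [simp]:
  assumes "X \<in> tensor_power scale 3"
  shows "tensor3_mult scale (pure scale [1, 1, 1]) X = X"
  using assms by (induction X rule: tensor_power3_induct) (simp_all add: tensor3_mult_pure tensor3_mult_add_right)

lemma linear_scale: "Vector_Spaces.linear scale scale (\<lambda>x. scale c x)"
  by (simp add: Vector_Spaces.linear_iff vector_space_axioms algebra_simps scale_right_distrib)

lemma tensor3_scale_map3: "tensor3_scale scale c X = tensor_map3 scale (\<lambda>x. scale c x) (\<lambda>x. x) (\<lambda>x. x) X"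
  by (simp add: tensor3_scale_def tensor_map3_def)

text \<open>Turns compatibility with scalars into a case of multiplicativity, which is how
  \<open>mu_ext_scale\<close> obtains it.\<close>

lemma tensor3_scale_mult:
  assumes "X \<in> tensor_power scale 3"
  shows "tensor3_scale scale c X = tensor3_mult scale (pure scale [scale c 1, 1, 1]) X"
  using assms
  by (induction X rule: tensor_power3_induct)
     (simp_all add: tensor3_scale_map3 tensor_map3_pure[OF linear_scale linear_ident linear_ident]
        tensor_map3_add[OF linear_scale linear_ident linear_ident] tensor3_mult_pure
        tensor3_mult_add_right scale_mult_left)

lemma tensor_lift3_scale:
  assumes "trilinear_into scale s n \<phi>" "X \<in> tensor_power scale 3"
  shows "tensor_lift3 s n \<phi> (tensor3_scale scale c X) = tensor_lift3 s n (\<lambda>x y w. \<phi> (scale c x) y w) X"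
proof -
  have t: "trilinear_into scale s n (\<lambda>x y w. \<phi> (scale c x) y w)"
    by (rule trilinear_intoI) (simp_all add: trilinear_intoD[OF assms(1)] scale_right_distrib mult.commute)
  note m = linear_scale linear_ident linear_ident
  show ?thesis
    using assms(2)
    by (induction X rule: tensor_power3_induct)
       (simp_all add: tensor3_scale_map3 tensor_map3_pure[OF m] tensor_map3_add[OF m]
          tensor_lift3_pure[OF t] tensor_lift3_pure[OF assms(1)]
          tensor_lift3_add[OF t] tensor_lift3_add[OF assms(1)] tensor_map3_in_tensor_power[OF m])
qed

end

section \<open>Coassociativity and unit laws on products\<close>

definition tensor_map2 ::
    "('k::field \<Rightarrow> 'a::ab_group_add \<Rightarrow> 'a) \<Rightarrow> ('b \<Rightarrow> 'a) \<Rightarrow> ('b \<Rightarrow> 'a) \<Rightarrow> 'b tensor \<Rightarrow> 'a tensor" where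
  "tensor_map2 s f h X = tensor_lift s 2 (\<lambda>w. pure s [f (w ! 0), h (w ! 1)]) X"

lemma tensor_map2:
  assumes "Vector_Spaces.linear s' s f" "Vector_Spaces.linear s' s h"
  shows "tensor_map2 s f h (pure s' [x, y]) = pure s [f x, h y]"
    and "X \<in> tensor_power s' 2 \<Longrightarrow> Y \<in> tensor_power s' 2 \<Longrightarrow>
      tensor_map2 s f h (X \<oplus>\<^sub>t Y) = tensor_map2 s f h X \<oplus>\<^sub>t tensor_map2 s f h Y"
proof -
  have m: "multilinear_into s' 2 s 2 (\<lambda>w. pure s [f (w ! 0), h (w ! 1)])"
    using multilinear_into_pure_map[of 2 s' s "\<lambda>i. if i = 0 then f else h"] assms
    by (simp add: eval_nat_numeral)
  show "tensor_map2 s f h (pure s' [x, y]) = pure s [f x, h y]"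
    unfolding tensor_map2_def by (subst tensor_lift_pure) (use m in \<open>simp_all add: numeral_2_eq_2\<close>)
  show "X \<in> tensor_power s' 2 \<Longrightarrow> Y \<in> tensor_power s' 2 \<Longrightarrow>
      tensor_map2 s f h (X \<oplus>\<^sub>t Y) = tensor_map2 s f h X \<oplus>\<^sub>t tensor_map2 s f h Y"
    unfolding tensor_map2_def by (rule tensor_lift_add[OF m])
qed

text \<open>Collects what is known of the extended map before coassociativity and the unit laws are
  available; it is instantiated both with \<mu> on A and with \<open>mu_ext\<close> on H.\<close>

locale tensor3_hom = k_algebra scale
  for scale :: "'k::field \<Rightarrow> 'a::ring_1 \<Rightarrow> 'a" +
  fixes \<mu> :: "'a \<Rightarrow> 'a tensor"
  assumes map_closed [simp]: "\<mu> r \<in> tensor_power scale 3"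
    and map_add: "\<mu> (r + r') = \<mu> r \<oplus>\<^sub>t \<mu> r'"
    and map_scale: "\<mu> (scale c r) = tensor3_scale scale c (\<mu> r)"
    and map_mult: "\<mu> (r * r') = tensor3_mult scale (\<mu> r) (\<mu> r')"
begin

lemma trilinear_into_pure5:
  "trilinear_into scale scale 5 (\<lambda>x y w. pure scale [x, y, w, b, c])"
  "trilinear_into scale scale 5 (\<lambda>x y w. pure scale [b, c, x, y, w])"
  by (rule trilinear_intoI; simp add: pure_add_nth pure_scale_nth)+

text \<open>\<open>mu_left\<close> is \<open>\<mu> \<otimes> id \<otimes> id\<close> and \<open>mu_right\<close> is \<open>id \<otimes> id \<otimes> \<mu>\<close>.\<close>

definition mu_left :: "'a tensor \<Rightarrow> 'a tensor" where
  "mu_left = tensor_lift3 scale 5 (\<lambda>a b c. tensor_lift3 scale 5 (\<lambda>x y w. pure scale [x, y, w, b, c]) (\<mu> a))"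

definition mu_right :: "'a tensor \<Rightarrow> 'a tensor" where
  "mu_right = tensor_lift3 scale 5 (\<lambda>a b c. tensor_lift3 scale 5 (\<lambda>x y w. pure scale [a, b, x, y, w]) (\<mu> c))"

text \<open>The arguments b and c are parameters of the inner lift, so their additivity is not an
  instance of \<open>tensor_lift3_add\<close>; the outer lift in \<open>mu_left\<close> relies on
  it.\<close>

lemma tensor_lift3_pure5_left:
  "tensor_lift3 scale 5 (\<lambda>x y w. pure scale [x, y, w, b + b', c]) X
    = tensor_lift3 scale 5 (\<lambda>x y w. pure scale [x, y, w, b, c]) X
      \<oplus>\<^sub>t tensor_lift3 scale 5 (\<lambda>x y w. pure scale [x, y, w, b', c]) X" (is ?A)
  "tensor_lift3 scale 5 (\<lambda>x y w. pure scale [x, y, w, b, c + c']) X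
    = tensor_lift3 scale 5 (\<lambda>x y w. pure scale [x, y, w, b, c]) X
      \<oplus>\<^sub>t tensor_lift3 scale 5 (\<lambda>x y w. pure scale [x, y, w, b, c']) X" (is ?B)
  if "X \<in> tensor_power scale 3"
proof -
  show ?A
    using tensor_lift3_plus[OF trilinear_into_pure5(1)[of b c] trilinear_into_pure5(1)[of b' c] _ that]
      trilinear_into_pure5(1)[of "b + b'" c] by (simp add: pure_add_nth)
  show ?B
    using tensor_lift3_plus[OF trilinear_into_pure5(1)[of b c] trilinear_into_pure5(1)[of b c'] _ that]
      trilinear_into_pure5(1)[of b "c + c'"] by (simp add: pure_add_nth)
qed

lemma tensor_lift3_pure5_right:
  "tensor_lift3 scale 5 (\<lambda>x y w. pure scale [a + a', b, x, y, w]) X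
    = tensor_lift3 scale 5 (\<lambda>x y w. pure scale [a, b, x, y, w]) X
      \<oplus>\<^sub>t tensor_lift3 scale 5 (\<lambda>x y w. pure scale [a', b, x, y, w]) X" (is ?A)
  "tensor_lift3 scale 5 (\<lambda>x y w. pure scale [a, b + b', x, y, w]) X
    = tensor_lift3 scale 5 (\<lambda>x y w. pure scale [a, b, x, y, w]) X
      \<oplus>\<^sub>t tensor_lift3 scale 5 (\<lambda>x y w. pure scale [a, b', x, y, w]) X" (is ?B)
  if "X \<in> tensor_power scale 3"
proof -
  show ?A
    using tensor_lift3_plus[OF trilinear_into_pure5(2)[of a b] trilinear_into_pure5(2)[of a' b] _ that]
      trilinear_into_pure5(2)[of "a + a'" b] by (simp add: pure_add_nth)
  show ?B
    using tensor_lift3_plus[OF trilinear_into_pure5(2)[of a b] trilinear_into_pure5(2)[of a b'] _ that]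
      trilinear_into_pure5(2)[of a "b + b'"] by (simp add: pure_add_nth)
qed

lemma trilinear_into_mu_left:
  "trilinear_into scale scale 5 (\<lambda>a b c. tensor_lift3 scale 5 (\<lambda>x y w. pure scale [x, y, w, b, c]) (\<mu> a))"
  by (rule trilinear_intoI)
     (simp_all add: tensor_lift3_in_tensor_power[OF trilinear_into_pure5(1)]
       tensor_lift3_add[OF trilinear_into_pure5(1)] map_add tensor_lift3_pure5_left
       map_scale tensor_lift3_scale[OF trilinear_into_pure5(1)] pure_scale_nth)

lemma trilinear_into_mu_right:
  "trilinear_into scale scale 5 (\<lambda>a b c. tensor_lift3 scale 5 (\<lambda>x y w. pure scale [a, b, x, y, w]) (\<mu> c))"
  by (rule trilinear_intoI)
     (simp_all add: tensor_lift3_in_tensor_power[OF trilinear_into_pure5(2)]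
       tensor_lift3_add[OF trilinear_into_pure5(2)] map_add tensor_lift3_pure5_right
       map_scale tensor_lift3_scale[OF trilinear_into_pure5(2)] pure_scale_nth)

lemmas mu_left_pure = tensor_lift3_pure[OF trilinear_into_mu_left, folded mu_left_def]
  and mu_left_add = tensor_lift3_add[OF trilinear_into_mu_left, folded mu_left_def]
  and mu_left_closed [simp] = tensor_lift3_in_tensor_power[OF trilinear_into_mu_left, folded mu_left_def]
lemmas mu_right_pure = tensor_lift3_pure[OF trilinear_into_mu_right, folded mu_right_def]
  and mu_right_add = tensor_lift3_add[OF trilinear_into_mu_right, folded mu_right_def]
  and mu_right_closed [simp] = tensor_lift3_in_tensor_power[OF trilinear_into_mu_right, folded mu_right_def]

text \<open>The triple occupies positions 0 to 2 or 2 to 4. Both offsets are even, so its opposite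
  factor falls on an opposite position of the five-fold product. The order of b, b' and c, c'
  follows the parity of the positions left over.\<close>

lemma tensor_lift3_pure5_mult:
  assumes "X \<in> tensor_power scale 3" "Y \<in> tensor_power scale 3"
  shows "tensor_lift3 scale 5 (\<lambda>x y w. pure scale [x, y, w, b' * b, c * c']) (tensor3_mult scale X Y)
      = tensor_mult scale 5 (tensor_lift3 scale 5 (\<lambda>x y w. pure scale [x, y, w, b, c]) X)
          (tensor_lift3 scale 5 (\<lambda>x y w. pure scale [x, y, w, b', c']) Y)" (is ?A)
    and "tensor_lift3 scale 5 (\<lambda>x y w. pure scale [b * b', c' * c, x, y, w]) (tensor3_mult scale X Y)
      = tensor_mult scale 5 (tensor_lift3 scale 5 (\<lambda>x y w. pure scale [b, c, x, y, w]) X)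
          (tensor_lift3 scale 5 (\<lambda>x y w. pure scale [b', c', x, y, w]) Y)" (is ?B)
proof -
  note [simp] = trilinear_into_pure5[THEN tensor_lift3_pure] trilinear_into_pure5[THEN tensor_lift3_add]
    trilinear_into_pure5[THEN tensor_lift3_in_tensor_power]
  have "?A \<and> ?B" using assms(1)
  proof (induction X rule: tensor_power3_induct)
    case (pure x y w)
    show ?case
      using assms(2)
      by (induction Y rule: tensor_power3_induct)
         (simp_all add: tensor3_mult_pure tensor3_mult_add_right tensor5_mult_pure tensor_mult_add_right)
  next
    case (add X X')
    then show ?case
      using assms(2) by (simp add: tensor3_mult_add_left tensor_mult_add_left)
  qed
  then show ?A ?B by blast+
qed

lemma mu_left_right_mult:
  assumes "X \<in> tensor_power scale 3" "Y \<in> tensor_power scale 3"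
  shows "mu_left (tensor3_mult scale X Y) = tensor_mult scale 5 (mu_left X) (mu_left Y)" (is ?A)
    and "mu_right (tensor3_mult scale X Y) = tensor_mult scale 5 (mu_right X) (mu_right Y)" (is ?B)
proof -
  have "?A \<and> ?B" using assms(1)
  proof (induction X rule: tensor_power3_induct)
    case (pure x y w)
    show ?case
      using assms(2)
      by (induction Y rule: tensor_power3_induct)
         (simp_all add: tensor3_mult_pure tensor3_mult_add_right tensor_mult_add_right
            mu_left_pure mu_left_add mu_right_pure mu_right_add
            map_mult tensor_lift3_pure5_mult trilinear_into_pure5[THEN tensor_lift3_in_tensor_power])
  next
    case (add X X')
    then show ?case
      using assms(2) by (simp add: tensor3_mult_add_left tensor_mult_add_left mu_left_add mu_right_add)
  qed
  then show ?A ?B by blast+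
qed

text \<open>Both iterates of \<mu> are multiplicative, and the set where two multiplicative maps
  agree is closed under products.\<close>

lemma coassoc_mult:
  assumes "mu_left (\<mu> r) = mu_right (\<mu> r)" "mu_left (\<mu> r') = mu_right (\<mu> r')"
  shows "mu_left (\<mu> (r * r')) = mu_right (\<mu> (r * r'))"
  by (simp add: map_mult mu_left_right_mult assms)

end

section \<open>Unit laws as contractions, and their behaviour on products\<close>

context k_algebra
begin

definition counit_left :: "'a tensor \<Rightarrow> 'a tensor" where
  "counit_left = tensor_lift3 scale 2 (\<lambda>a b c. pure scale [a * b, c])"

definition counit_right :: "'a tensor \<Rightarrow> 'a tensor" where
  "counit_right = tensor_lift3 scale 2 (\<lambda>a b c. pure scale [a, b * c])"

lemma trilinear_into_counit:
  "trilinear_into scale scale 2 (\<lambda>a b c. pure scale [a * b, c])"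
  "trilinear_into scale scale 2 (\<lambda>a b c. pure scale [a, b * c])"
  by (rule trilinear_intoI; simp add: algebra_simps pure_add_nth pure_scale_nth scale_mult_left scale_mult_right)+

lemmas counit_left_pure = tensor_lift3_pure[OF trilinear_into_counit(1), folded counit_left_def]
  and counit_left_add = tensor_lift3_add[OF trilinear_into_counit(1), folded counit_left_def]
  and counit_left_closed [simp] = tensor_lift3_in_tensor_power[OF trilinear_into_counit(1), folded counit_left_def]
lemmas counit_right_pure = tensor_lift3_pure[OF trilinear_into_counit(2), folded counit_right_def]
  and counit_right_add = tensor_lift3_add[OF trilinear_into_counit(2), folded counit_right_def]
  and counit_right_closed [simp] = tensor_lift3_in_tensor_power[OF trilinear_into_counit(2), folded counit_right_def]

lemma linear_mult_both: "Vector_Spaces.linear scale scale (\<lambda>x. a * (x * b))"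
  using linear_compose_fun[OF linear_mult_right linear_mult_left] .

text \<open>The contraction m \<otimes> id is not multiplicative in general. On a product it yields
  a (a' b') b, with the contraction of Y sandwiched between the factors of X; when that inner part
  collapses to 1, only a b \<otimes> c y remains. Hence the law is assumed of Y, while X is
  arbitrary.\<close>

lemma counit_left_mult:
  assumes "X \<in> tensor_power scale 3" "Y \<in> tensor_power scale 3" "counit_left Y = pure scale [1, y]"
  shows "counit_left (tensor3_mult scale X Y) = tensor_map2 scale (\<lambda>u. u) (\<lambda>u. u * y) (counit_left X)"
proof -
  have 1: "counit_left (tensor3_mult scale (pure scale [a, b, c]) Y)
      = tensor_map2 scale (\<lambda>u. a * (u * b)) (\<lambda>u. c * u) (counit_left Y)" for a b c
    using assms(2)
    by (induction Y rule: tensor_power3_induct)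
       (simp_all add: tensor3_mult_pure tensor3_mult_add_right counit_left_pure counit_left_add
         tensor_map2[OF linear_mult_both linear_mult_left] mult.assoc)
  show ?thesis
    using assms(1)
    by (induction X rule: tensor_power3_induct)
       (simp_all add: 1 assms(2,3) tensor3_mult_add_left counit_left_pure counit_left_add
         tensor_map2[OF linear_mult_both linear_mult_left] tensor_map2[OF linear_ident linear_mult_right])
qed

text \<open>Here the contraction is b' (b c) c', so the inner factor is X and the law is assumed of
  X.\<close>

lemma counit_right_mult:
  assumes "X \<in> tensor_power scale 3" "Y \<in> tensor_power scale 3" "counit_right X = pure scale [x, 1]"
  shows "counit_right (tensor3_mult scale X Y) = tensor_map2 scale (\<lambda>u. x * u) (\<lambda>u. u) (counit_right Y)"
proof -
  have 1: "counit_right (tensor3_mult scale X (pure scale [a, b, c]))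
      = tensor_map2 scale (\<lambda>u. u * a) (\<lambda>u. b * (u * c)) (counit_right X)" for a b c
    using assms(1)
    by (induction X rule: tensor_power3_induct)
       (simp_all add: tensor3_mult_pure tensor3_mult_add_left counit_right_pure counit_right_add
         tensor_map2[OF linear_mult_right linear_mult_both] mult.assoc)
  show ?thesis
    using assms(2)
    by (induction Y rule: tensor_power3_induct)
       (simp_all add: 1 assms(1,3) tensor3_mult_add_right counit_right_pure counit_right_add
         tensor_map2[OF linear_mult_right linear_mult_both] tensor_map2[OF linear_mult_left linear_ident])
qed

end

section \<open>The Hopf-Galois map of an Ore extension\<close>

locale ore_extension_of_hopf_galois = ore_extension scaleA \<tau> \<delta> scaleH \<iota> z + HG: hopf_galois_algebra scaleA \<mu>
  for scaleA :: "'k::field \<Rightarrow> 'a::ring_1 \<Rightarrow> 'a" and \<tau> \<delta> :: "'a \<Rightarrow> 'a"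
    and scaleH :: "'k \<Rightarrow> 'h::ring_1 \<Rightarrow> 'h" and \<iota> :: "'a \<Rightarrow> 'h" and z :: 'h
    and \<mu> :: "'a \<Rightarrow> 'a tensor" +
  fixes g :: 'a
  assumes group_like: "group_like scaleA \<mu> g"
    and bij_tau: "bij \<tau>"
begin

section \<open>The inverse of g and linearity of the structure maps\<close>

abbreviation gi :: 'a where "gi \<equiv> inv_elt g"

lemma g_gi [simp]: "g * gi = 1" "gi * g = 1"
proof -
  obtain h where h: "g * h = 1" "h * g = 1"
    using group_like by (auto simp: group_like_def invertible_elt_def)
  have "g * gi = 1 \<and> gi * g = 1"
    unfolding inv_elt_def
  proof (rule theI)
    show "g * h = 1 \<and> h * g = 1" using h by simp
    fix h' assume h': "g * h' = 1 \<and> h' * g = 1"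
    have "h' = h' * (g * h)" using h by simp
    also have "\<dots> = h" using h' by (simp flip: mult.assoc)
    finally show "h' = h" .
  qed
  then show "g * gi = 1" "gi * g = 1" by auto
qed

lemma g_gi_cancel [simp]: "g * (gi * x) = x" "gi * (g * x) = x"
  by (simp_all flip: mult.assoc)

lemma mu_g: "\<mu> g = pure scaleA [g, gi, g]"
  using group_like by (simp add: group_like_def)

lemma iota_linear: "Vector_Spaces.linear scaleA scaleH \<iota>"
  and iota_one [simp]: "\<iota> 1 = 1"
  and iota_mult: "\<iota> (x * y) = \<iota> x * \<iota> y"
  using iota_hom by (auto simp: algebra_hom_def)

lemma iota_add: "\<iota> (x + y) = \<iota> x + \<iota> y"
  and iota_scale: "\<iota> (scaleA c x) = scaleH c (\<iota> x)"
  using linear_map_add[OF iota_linear] linear_map_scale[OF iota_linear] by blast+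

lemma iota_zero [simp]: "\<iota> 0 = 0"
  using iota_add[of 0 0] by simp

lemma iota_uminus: "\<iota> (- x) = - \<iota> x"
  using iota_add[of x "- x"] by (simp add: eq_neg_iff_add_eq_0 add.commute)

lemma tau_linear: "Vector_Spaces.linear scaleA scaleA \<tau>"
  using tau_hom by (simp add: algebra_hom_def)

lemma inv_tau [simp]: "\<tau> (inv \<tau> x) = x" "inv \<tau> (\<tau> x) = x"
  using bij_tau by (simp_all add: bij_is_surj bij_is_inj surj_f_inv_f)

lemma inv_tau_linear: "Vector_Spaces.linear scaleA scaleA (inv \<tau>)"
proof -
  have "inv \<tau> (x + y) = inv \<tau> x + inv \<tau> y" for x y
    using linear_map_add[OF tau_linear, of "inv \<tau> x" "inv \<tau> y"] by (metis inv_tau)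
  moreover have "inv \<tau> (scaleA c x) = scaleA c (inv \<tau> x)" for c x
    using linear_map_scale[OF tau_linear, of c "inv \<tau> x"] by (metis inv_tau)
  ultimately show ?thesis by (simp add: Vector_Spaces.linear_iff A.vector_space_axioms)
qed

lemma linear_uminus:
  "Vector_Spaces.linear s scaleA f \<Longrightarrow> Vector_Spaces.linear s scaleA (\<lambda>x. - f x)"
  "Vector_Spaces.linear s scaleH f' \<Longrightarrow> Vector_Spaces.linear s scaleH (\<lambda>x. - f' x)"
  by (simp_all add: Vector_Spaces.linear_iff)

lemma linear_zero: "Vector_Spaces.linear scaleA scaleA (\<lambda>x. 0)"
  by (simp add: Vector_Spaces.linear_iff A.vector_space_axioms)

text \<open>With these closure rules the simplifier discharges the linearity premises of the
  \<open>tensor_map3\<close> rules.\<close>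

lemmas linear_rules [simp] =
  linear_zero
  A.linear_ident H.linear_ident linear_uminus
  iota_linear tau_linear inv_tau_linear delta_linear
  linear_compose_fun[OF _ iota_linear] linear_compose_fun[OF _ tau_linear]
  linear_compose_fun[OF _ inv_tau_linear] linear_compose_fun[OF _ delta_linear]
  A.linear_mult_left H.linear_mult_left A.linear_mult_right H.linear_mult_right
  linear_compose_fun[OF _ A.linear_mult_left] linear_compose_fun[OF _ H.linear_mult_left]
  linear_compose_fun[OF _ A.linear_mult_right] linear_compose_fun[OF _ H.linear_mult_right]

section \<open>Coefficients of elements of H\<close>

definition ore_sum :: "'a poly \<Rightarrow> 'h" where
  "ore_sum p = (\<Sum>i\<le>degree p. \<iota> (poly.coeff p i) * z ^ i)"

lemma bij_ore_sum: "bij ore_sum"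
  using ore_basis unfolding ore_sum_def .

text \<open>Coefficients stand to the left of the powers of z, so right multiplication by z merely
  shifts them; neither \<tau> nor \<delta> intervenes. This makes the step from h to \<iota> a + h z
  a convenient recursion and induction scheme.\<close>

lemma ore_sum_pCons [simp]: "ore_sum (pCons a p) = \<iota> a + ore_sum p * z"
proof (cases "p = 0")
  case False
  then show ?thesis
    unfolding ore_sum_def
    by (simp add: degree_pCons_eq sum.atMost_Suc_shift sum_distrib_right mult.assoc power_Suc2
          del: sum.atMost_Suc power_Suc)
qed (simp add: ore_sum_def)

lemma ore_sum_0 [simp]: "ore_sum 0 = 0"
  by (simp add: ore_sum_def)

lemma ore_sum_add: "ore_sum (p + q) = ore_sum p + ore_sum q"
  by (induction p q rule: poly_induct2) (simp_all add: iota_add algebra_simps)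

definition ore_coeffs :: "'h \<Rightarrow> 'a poly" where "ore_coeffs = inv ore_sum"

lemma ore_coeffs_ore_sum [simp]: "ore_coeffs (ore_sum p) = p"
  and ore_sum_ore_coeffs [simp]: "ore_sum (ore_coeffs h) = h"
  using bij_ore_sum by (simp_all add: ore_coeffs_def bij_is_inj bij_is_surj surj_f_inv_f)

lemma ore_coeffs_add: "ore_coeffs (h + h') = ore_coeffs h + ore_coeffs h'"
  by (metis ore_coeffs_ore_sum ore_sum_ore_coeffs ore_sum_add)

lemma ore_coeffs_shift: "ore_coeffs (\<iota> a + h * z) = pCons a (ore_coeffs h)"
  by (metis ore_coeffs_ore_sum ore_sum_ore_coeffs ore_sum_pCons)

lemma ore_coeffs_0 [simp]: "ore_coeffs 0 = 0"
  by (metis ore_coeffs_ore_sum ore_sum_0)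

lemma ore_induct [case_names zero shift]:
  assumes "P 0" "\<And>a h. P h \<Longrightarrow> P (\<iota> a + h * z)"
  shows "P h"
proof -
  have "P (ore_sum p)" for p by (induction p) (simp_all add: assms)
  then show ?thesis by (metis ore_sum_ore_coeffs)
qed

text \<open>Being k-linear, these maps may be applied factorwise to tensors over H.\<close>

definition coeff_map :: "nat \<Rightarrow> 'h \<Rightarrow> 'a" where "coeff_map i h = poly.coeff (ore_coeffs h) i"

lemma scaleH_eq: "scaleH c h = \<iota> (scaleA c 1) * h"
  by (simp add: iota_scale H.scale_mult_left)

lemma coeff_map_scale: "coeff_map i (scaleH c h) = scaleA c (coeff_map i h)"
proof (induction h arbitrary: i rule: ore_induct)
  case (shift a h)
  have "scaleH c (\<iota> a + h * z) = \<iota> (scaleA c a) + scaleH c h * z"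
    by (simp add: H.scale_right_distrib iota_scale H.scale_mult_left)
  then show ?case
    using shift by (cases i) (simp_all add: coeff_map_def ore_coeffs_shift)
qed (simp add: coeff_map_def)

lemma coeff_map_linear [simp]: "Vector_Spaces.linear scaleH scaleA (coeff_map i)"
  by (simp add: Vector_Spaces.linear_iff A.vector_space_axioms H.vector_space_axioms coeff_map_scale)
     (simp add: coeff_map_def ore_coeffs_add)

lemmas linear_coeff_map [simp] = linear_compose_fun[OF _ coeff_map_linear]

text \<open>Indices 0 and 1 suffice: each factor on either side of the equation for \<mu>(z) has
  degree at most one in z.\<close>

lemma coeff_map_simps [simp]:
  "coeff_map 0 (\<iota> a) = a" "coeff_map (Suc 0) (\<iota> a) = 0"
  "coeff_map 0 (\<iota> a * z) = 0" "coeff_map (Suc 0) (\<iota> a * z) = a"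
  using ore_coeffs_shift[of a 0] ore_coeffs_shift[of 0 "\<iota> a"] ore_coeffs_shift[of a 0]
  by (simp_all add: coeff_map_def)

text \<open>In \<open>map_add\<close>, \<open>map_closed\<close> and \<open>map_zero\<close> the
  scalar action of the source occurs only in the premises, so it is fixed in advance for
  rewriting.\<close>

lemmas map_pure [simp] = tensor_map3_pure[where s'=scaleA] tensor_map3_pure[where s'=scaleH]
lemmas map_add [simp] = tensor_map3_add[where s'=scaleA] tensor_map3_add[where s'=scaleH]
lemmas map_closed [simp] = tensor_map3_in_tensor_power[where s'=scaleA] tensor_map3_in_tensor_power[where s'=scaleH]
lemmas map_zero [simp] = tensor_map3_zero[where s'=scaleA]
lemmas mu_closed [simp] = HG.mu_closed

lemma map_comp [simp]:
  assumes "X \<in> tensor_power scaleA 3"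
    "Vector_Spaces.linear scaleA scaleH f" "Vector_Spaces.linear scaleA scaleH f'" "Vector_Spaces.linear scaleA scaleH f''"
  shows "tensor_map3 scaleA (coeff_map i) (coeff_map j) (coeff_map k) (tensor_map3 scaleH f f' f'' X)
    = tensor_map3 scaleA (\<lambda>x. coeff_map i (f x)) (\<lambda>x. coeff_map j (f' x)) (\<lambda>x. coeff_map k (f'' x)) X"
  by (rule tensor_map3_comp) (use assms in simp_all)

lemmas map_compA [simp] = tensor_map3_comp[where s'=scaleA and s=scaleA]

lemma map_id [simp]: "X \<in> tensor_power scaleA 3 \<Longrightarrow> tensor_map3 scaleA (\<lambda>x. x) (\<lambda>x. x) (\<lambda>x. x) X = X"
  by (rule tensor_map3_id[OF A.vector_space_axioms])

section \<open>The images of \<mu>(a) and of z in the third tensor power of H\<close>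

definition mu_iota :: "'a \<Rightarrow> 'h tensor" where "mu_iota a = tensor_map3 scaleH \<iota> \<iota> \<iota> (\<mu> a)"

lemma mu_iota_closed [simp]: "mu_iota a \<in> tensor_power scaleH 3"
  by (simp add: mu_iota_def)

lemma mu_iota_add: "mu_iota (a + b) = mu_iota a \<oplus>\<^sub>t mu_iota b"
  by (simp add: mu_iota_def HG.mu_add)

lemma map_iota_mult:
  assumes "X \<in> tensor_power scaleA 3" "Y \<in> tensor_power scaleA 3"
  shows "tensor_map3 scaleH \<iota> \<iota> \<iota> (tensor3_mult scaleA X Y)
    = tensor3_mult scaleH (tensor_map3 scaleH \<iota> \<iota> \<iota> X) (tensor_map3 scaleH \<iota> \<iota> \<iota> Y)"
  using assms(1)
proof (induction X rule: tensor_power3_induct)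
  case (pure x y w)
  show ?case
    using assms(2)
    by (induction Y rule: tensor_power3_induct)
       (simp_all add: A.tensor3_mult_pure H.tensor3_mult_pure iota_mult
          A.tensor3_mult_add_right H.tensor3_mult_add_right)
qed (use assms(2) in \<open>simp add: A.tensor3_mult_add_left H.tensor3_mult_add_left\<close>)

lemma map_iota_zero: "tensor_map3 scaleH \<iota> \<iota> \<iota> (tensor_zero scaleA 3) = tensor_zero scaleH 3"
proof -
  have "tensor_zero scaleA 3 = pure scaleA [0, 0, 0]" "tensor_zero scaleH 3 = pure scaleH [0, 0, 0]"
    by (simp_all add: pure_zero_nth numeral_3_eq_3)
  then show ?thesis by simp
qed

lemma mu_iota_mult: "mu_iota (a * b) = tensor3_mult scaleH (mu_iota a) (mu_iota b)"
  by (simp add: mu_iota_def HG.mu_mult map_iota_mult)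

lemma mu_iota_one [simp]: "mu_iota 1 = pure scaleH [1, 1, 1]"
  by (simp add: mu_iota_def HG.mu_one)

lemma mu_iota_scale_one: "mu_iota (scaleA c 1) = pure scaleH [scaleH c 1, 1, 1]"
  by (simp add: mu_iota_def HG.mu_scale HG.mu_one A.tensor3_scale_map3 A.linear_scale iota_scale)

text \<open>The minus sign is placed on g in the first factor, so that additivity rules alone handle
  all expansions; \<open>mu_z_eq\<close> returns to the difference.\<close>

definition mu_z :: "'h tensor" where
  "mu_z = pure scaleH [z, 1, 1] \<oplus>\<^sub>t pure scaleH [\<iota> g, \<iota> gi, z] \<oplus>\<^sub>t pure scaleH [\<iota> (- g), \<iota> gi * z, 1]"

lemma mu_z_closed [simp]: "mu_z \<in> tensor_power scaleH 3"
  by (simp add: mu_z_def)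

lemma mu_z_eq: "mu_z = pure scaleH [z, 1, 1] \<oplus>\<^sub>t pure scaleH [\<iota> g, \<iota> gi, z] \<ominus>\<^sub>t pure scaleH [\<iota> g, \<iota> gi * z, 1]"
  by (simp add: mu_z_def tensor_diff_pure iota_uminus)

text \<open>The commutation relation is applied in the outer factors only, splitting two of the
  three terms of \<open>mu_z\<close>. In the opposite factor z already stands to the right of
  y.\<close>

lemma mu_z_times_map:
  assumes "X \<in> tensor_power scaleA 3"
  shows "tensor3_mult scaleH mu_z (tensor_map3 scaleH \<iota> \<iota> \<iota> X)
    = tensor_map3 scaleH (\<lambda>x. \<iota> (\<tau> x) * z) \<iota> \<iota> X
      \<oplus>\<^sub>t tensor_map3 scaleH (\<lambda>x. \<iota> (\<delta> x)) \<iota> \<iota> X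
      \<oplus>\<^sub>t tensor_map3 scaleH (\<lambda>x. \<iota> (g * x)) (\<lambda>y. \<iota> (y * gi)) (\<lambda>w. \<iota> (\<tau> w) * z) X
      \<oplus>\<^sub>t tensor_map3 scaleH (\<lambda>x. \<iota> (g * x)) (\<lambda>y. \<iota> (y * gi)) (\<lambda>w. \<iota> (\<delta> w)) X
      \<oplus>\<^sub>t tensor_map3 scaleH (\<lambda>x. \<iota> (- (g * x))) (\<lambda>y. \<iota> (y * gi) * z) \<iota> X"
  using assms
proof (induction X rule: tensor_power3_induct)
  case (pure x y w)
  show ?case
    by (simp add: mu_z_def H.tensor3_mult_pure H.tensor3_mult_add_left H.tensor3_mult_add_right
        ore_relation pure_add_nth iota_mult iota_uminus tensor_add_ac mult.assoc)
next
  case (add X Y)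
  then show ?case
    by (simp add: H.tensor3_mult_add_left H.tensor3_mult_add_right tensor_add_ac)
qed

text \<open>The reverse situation: only the opposite factor puts z to the left of an element of A,
  so only the third term of \<open>mu_z\<close> splits.\<close>

lemma map_times_mu_z:
  assumes "X \<in> tensor_power scaleA 3"
  shows "tensor3_mult scaleH (tensor_map3 scaleH \<iota> \<iota> \<iota> X) mu_z
    = tensor_map3 scaleH (\<lambda>x. \<iota> x * z) \<iota> \<iota> X
      \<oplus>\<^sub>t tensor_map3 scaleH (\<lambda>x. \<iota> (x * g)) (\<lambda>y. \<iota> (gi * y)) (\<lambda>w. \<iota> w * z) X
      \<oplus>\<^sub>t tensor_map3 scaleH (\<lambda>x. \<iota> (- (x * g))) (\<lambda>y. \<iota> (gi * \<tau> y) * z) \<iota> X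
      \<oplus>\<^sub>t tensor_map3 scaleH (\<lambda>x. \<iota> (- (x * g))) (\<lambda>y. \<iota> (gi * \<delta> y)) \<iota> X"
  using assms
proof (induction X rule: tensor_power3_induct)
  case (pure x y w)
  show ?case
    by (simp add: mu_z_def H.tensor3_mult_pure H.tensor3_mult_add_left H.tensor3_mult_add_right
        ore_relation pure_add_nth iota_mult iota_uminus tensor_add_ac mult.assoc distrib_left)
next
  case (add X Y)
  then show ?case
    by (simp add: H.tensor3_mult_add_left H.tensor3_mult_add_right tensor_add_ac)
qed

section \<open>Commutation of \<mu>(z) with \<mu>(A) and the three conditions\<close>

definition mu_z_commutes :: bool where
  "mu_z_commutes \<longleftrightarrow> (\<forall>a. tensor3_mult scaleH mu_z (mu_iota a) = tensor3_mult scaleH (mu_iota (\<tau> a)) mu_z \<oplus>\<^sub>t mu_iota (\<delta> a))"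

definition condition1 :: bool where
  "condition1 \<longleftrightarrow> (\<forall>a. \<mu> (\<tau> a) = tensor_map3 scaleA \<tau> (\<lambda>y. y) (\<lambda>w. w) (\<mu> a)
    \<and> \<mu> (\<tau> a) = tensor_map3 scaleA \<tau> \<tau> \<tau> (\<mu> a))"

definition condition2 :: bool where
  "condition2 \<longleftrightarrow> (\<forall>a. tensor_map3 scaleA (conj_by g) (conj_by g) (\<lambda>w. w) (\<mu> a)
    = tensor_map3 scaleA \<tau> \<tau> (\<lambda>w. w) (\<mu> a))"

definition condition3 :: bool where
  "condition3 \<longleftrightarrow> (\<forall>a. tensor_map3 scaleA \<delta> (\<lambda>y. y) (\<lambda>w. w) (\<mu> a)
    \<oplus>\<^sub>t tensor_map3 scaleA (\<lambda>x. g * x) (\<lambda>y. y * gi) \<delta> (\<mu> a)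
    \<oplus>\<^sub>t tensor_map3 scaleA (\<lambda>x. g * x) (\<lambda>y. gi * \<delta> (inv \<tau> (conj_by g y))) (\<lambda>w. w) (\<mu> a) = \<mu> (\<delta> a))"

lemma conj_by_linear [simp]: "Vector_Spaces.linear scaleA scaleA (conj_by g)"
  "Vector_Spaces.linear s scaleA f \<Longrightarrow> Vector_Spaces.linear s scaleA (\<lambda>x. conj_by g (f x))"
  unfolding conj_by_def by simp_all

text \<open>Replaces cancellation, as \<oplus> on sets has no inverses: opposite signs in the first
  factor sum to the zero map there.\<close>

lemma map_cancel:
  assumes "X \<in> tensor_power scaleA 3"
    "Vector_Spaces.linear scaleA scaleA f" "Vector_Spaces.linear scaleA scaleA f'" "Vector_Spaces.linear scaleA scaleA f''"
  shows "tensor_map3 scaleA (\<lambda>x. - f x) f' f'' X \<oplus>\<^sub>t tensor_map3 scaleA f f' f'' X = tensor_zero scaleA 3"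
  using tensor_map3_plus[of scaleA scaleA "\<lambda>x. - f x" f f' f'' X] assms by simp

lemma mu_z_commutes_imp_conditions:
  assumes "mu_z_commutes"
  shows "condition1" "condition2" "condition3"
proof -
  \<comment> \<open>\<open>E i j k\<close> extracts the coefficient of z^i \<otimes> z^j \<otimes>
    z^k. \<open>I\<close>, \<open>III\<close>, \<open>II\<close> and \<open>IV\<close> below are its
    four relevant instances.\<close>
  define E where "E i j k = tensor_map3 scaleA (coeff_map i) (coeff_map j) (coeff_map k)" for i j k
  have eq: "E i j k (tensor3_mult scaleH mu_z (mu_iota a)) = E i j k (tensor3_mult scaleH (mu_iota (\<tau> a)) mu_z \<oplus>\<^sub>t mu_iota (\<delta> a))"
    for i j k a using assms by (simp add: mu_z_commutes_def)
  note simps = E_def mu_iota_def mu_z_times_map map_times_mu_z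
  have I: "\<mu> (\<tau> a) = tensor_map3 scaleA \<tau> (\<lambda>y. y) (\<lambda>w. w) (\<mu> a)" for a
    using eq[of "Suc 0" 0 0 a] by (simp add: simps)
  have III: "tensor_map3 scaleA (\<lambda>x. - (g * x)) (\<lambda>y. y * gi) (\<lambda>w. w) (\<mu> a)
      = tensor_map3 scaleA (\<lambda>x. - (x * g)) (\<lambda>y. gi * \<tau> y) (\<lambda>w. w) (\<mu> (\<tau> a))" for a
    using eq[of 0 "Suc 0" 0 a] by (simp add: simps)
  have II: "tensor_map3 scaleA (\<lambda>x. g * x) (\<lambda>y. y * gi) \<tau> (\<mu> a)
      = tensor_map3 scaleA (\<lambda>x. x * g) (\<lambda>y. gi * y) (\<lambda>w. w) (\<mu> (\<tau> a))" for a
    using eq[of 0 0 "Suc 0" a] by (simp add: simps)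
  have IV: "tensor_map3 scaleA \<delta> (\<lambda>y. y) (\<lambda>w. w) (\<mu> a)
      \<oplus>\<^sub>t tensor_map3 scaleA (\<lambda>x. g * x) (\<lambda>y. y * gi) \<delta> (\<mu> a)
      = tensor_map3 scaleA (\<lambda>x. - (x * g)) (\<lambda>y. gi * \<delta> y) (\<lambda>w. w) (\<mu> (\<tau> a)) \<oplus>\<^sub>t \<mu> (\<delta> a)" for a
    using eq[of 0 0 0 a] by (simp add: simps)
  \<comment> \<open>The map applied to \<open>III\<close> undoes -(x g) and g^{-1} y. On the left it
    completes g x and y g^{-1} to conjugates; on the right \<open>I\<close> replaces \<mu>(\<tau>
    a).\<close>
  have 2: "tensor_map3 scaleA (conj_by g) (conj_by g) (\<lambda>w. w) (\<mu> a)
      = tensor_map3 scaleA \<tau> \<tau> (\<lambda>w. w) (\<mu> a)" for a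
    using arg_cong[OF III[of a], of "tensor_map3 scaleA (\<lambda>x. - (x * gi)) (\<lambda>y. g * y) (\<lambda>w. w)"]
    by (simp add: conj_by_def[abs_def] mult.assoc I)
  then show "condition2" by (simp add: condition2_def)
  \<comment> \<open>Conjugates appear as before, but with \<tau> in the third factor. Applying id
    \<otimes> id \<otimes> \<tau> to \<open>2\<close> converts them into the second form of
    (1).\<close>
  have "\<mu> (\<tau> a) = tensor_map3 scaleA (conj_by g) (conj_by g) \<tau> (\<mu> a)" for a
    using arg_cong[OF II[of a], of "tensor_map3 scaleA (\<lambda>x. x * gi) (\<lambda>y. g * y) (\<lambda>w. w)"]
    by (simp add: conj_by_def[abs_def] mult.assoc)
  moreover have "tensor_map3 scaleA (conj_by g) (conj_by g) \<tau> (\<mu> a) = tensor_map3 scaleA \<tau> \<tau> \<tau> (\<mu> a)" for a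
    using arg_cong[OF 2[of a], of "tensor_map3 scaleA (\<lambda>x. x) (\<lambda>y. y) \<tau>"] by simp
  ultimately show "condition1" using I by (simp add: condition1_def)
  show "condition3"
    unfolding condition3_def
  proof
    fix a
    \<comment> \<open>In the middle factor of \<open>2\<close>, applying g^{-1} \<delta>(\<tau>^{-1}
      y) cancels \<tau> on the right and leaves the \<tau>^{-1} of (3) on the left. This identifies
      the last term of (3) with the negative of the middle \<delta> term in
      \<open>IV\<close>.\<close>
    have N: "tensor_map3 scaleA (\<lambda>x. g * x) (\<lambda>y. gi * \<delta> (inv \<tau> (conj_by g y))) (\<lambda>w. w) (\<mu> a)
        = tensor_map3 scaleA (\<lambda>x. x * g) (\<lambda>y. gi * \<delta> y) (\<lambda>w. w) (\<mu> (\<tau> a))"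
      using arg_cong[OF 2[of a], of "tensor_map3 scaleA (\<lambda>x. x * g) (\<lambda>y. gi * \<delta> (inv \<tau> y)) (\<lambda>w. w)"]
      by (simp add: I) (simp add: conj_by_def[abs_def] mult.assoc)
    show "tensor_map3 scaleA \<delta> (\<lambda>y. y) (\<lambda>w. w) (\<mu> a)
      \<oplus>\<^sub>t tensor_map3 scaleA (\<lambda>x. g * x) (\<lambda>y. y * gi) \<delta> (\<mu> a)
      \<oplus>\<^sub>t tensor_map3 scaleA (\<lambda>x. g * x) (\<lambda>y. gi * \<delta> (inv \<tau> (conj_by g y))) (\<lambda>w. w) (\<mu> a) = \<mu> (\<delta> a)"
      unfolding N IV
      using map_cancel[of "\<mu> (\<tau> a)" "\<lambda>x. x * g" "\<lambda>y. gi * \<delta> y" "\<lambda>w. w"]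
      by (simp add: tensor_add_assoc tensor_add_commute[of "\<mu> (\<delta> a)"])
         (simp flip: tensor_add_assoc)
  qed
qed

lemma conditions_imp_mu_z_commutes:
  assumes "condition1" "condition2" "condition3"
  shows "mu_z_commutes"
  unfolding mu_z_commutes_def
proof
  fix a
  have I: "\<mu> (\<tau> a) = tensor_map3 scaleA \<tau> (\<lambda>y. y) (\<lambda>w. w) (\<mu> a)"
    and I': "\<mu> (\<tau> a) = tensor_map3 scaleA \<tau> \<tau> \<tau> (\<mu> a)"
    using assms(1) by (auto simp: condition1_def)
  have 2: "tensor_map3 scaleA (conj_by g) (conj_by g) (\<lambda>w. w) (\<mu> a)
      = tensor_map3 scaleA \<tau> \<tau> (\<lambda>w. w) (\<mu> a)"
    using assms(2) by (simp add: condition2_def)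
  have R1: "tensor_map3 scaleH (\<lambda>x. \<iota> x * z) \<iota> \<iota> (\<mu> (\<tau> a)) = tensor_map3 scaleH (\<lambda>x. \<iota> (\<tau> x) * z) \<iota> \<iota> (\<mu> a)"
    by (simp add: I)
  \<comment> \<open>The target has \<tau> in the third factor, so \<mu>(\<tau> a) is expanded by the
    second form of (1); \<open>R3\<close> and \<open>R4\<close> leave that factor alone and use the
    first form.\<close>
  have R2: "tensor_map3 scaleH (\<lambda>x. \<iota> (x * g)) (\<lambda>y. \<iota> (gi * y)) (\<lambda>w. \<iota> w * z) (\<mu> (\<tau> a))
      = tensor_map3 scaleH (\<lambda>x. \<iota> (g * x)) (\<lambda>y. \<iota> (y * gi)) (\<lambda>w. \<iota> (\<tau> w) * z) (\<mu> a)"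
    using arg_cong[OF 2, of "tensor_map3 scaleH (\<lambda>x. \<iota> (x * g)) (\<lambda>y. \<iota> (gi * y)) (\<lambda>w. \<iota> (\<tau> w) * z)"]
    by (simp add: I') (simp add: conj_by_def[abs_def] mult.assoc)
  have R3: "tensor_map3 scaleH (\<lambda>x. \<iota> (- (x * g))) (\<lambda>y. \<iota> (gi * \<tau> y) * z) \<iota> (\<mu> (\<tau> a))
      = tensor_map3 scaleH (\<lambda>x. \<iota> (- (g * x))) (\<lambda>y. \<iota> (y * gi) * z) \<iota> (\<mu> a)"
    using arg_cong[OF 2, of "tensor_map3 scaleH (\<lambda>x. \<iota> (- (x * g))) (\<lambda>y. \<iota> (gi * y) * z) \<iota>"]
    by (simp add: I) (simp add: conj_by_def[abs_def] mult.assoc)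
  have R4: "tensor_map3 scaleH (\<lambda>x. \<iota> (- (x * g))) (\<lambda>y. \<iota> (gi * \<delta> y)) \<iota> (\<mu> (\<tau> a))
      = tensor_map3 scaleH (\<lambda>x. \<iota> (- (g * x))) (\<lambda>y. \<iota> (gi * \<delta> (inv \<tau> (conj_by g y)))) \<iota> (\<mu> a)"
    using arg_cong[OF 2, of "tensor_map3 scaleH (\<lambda>x. \<iota> (- (x * g))) (\<lambda>y. \<iota> (gi * \<delta> (inv \<tau> y))) \<iota>"]
    by (simp add: I) (simp add: conj_by_def[abs_def] mult.assoc)
  have "mu_iota (\<delta> a) = tensor_map3 scaleH \<iota> \<iota> \<iota> (tensor_map3 scaleA \<delta> (\<lambda>y. y) (\<lambda>w. w) (\<mu> a)
    \<oplus>\<^sub>t tensor_map3 scaleA (\<lambda>x. g * x) (\<lambda>y. y * gi) \<delta> (\<mu> a)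
    \<oplus>\<^sub>t tensor_map3 scaleA (\<lambda>x. g * x) (\<lambda>y. gi * \<delta> (inv \<tau> (conj_by g y))) (\<lambda>w. w) (\<mu> a))"
    using assms(3) by (simp add: mu_iota_def condition3_def)
  then have D: "mu_iota (\<delta> a) = tensor_map3 scaleH (\<lambda>x. \<iota> (\<delta> x)) \<iota> \<iota> (\<mu> a)
    \<oplus>\<^sub>t tensor_map3 scaleH (\<lambda>x. \<iota> (g * x)) (\<lambda>y. \<iota> (y * gi)) (\<lambda>w. \<iota> (\<delta> w)) (\<mu> a)
    \<oplus>\<^sub>t tensor_map3 scaleH (\<lambda>x. \<iota> (g * x)) (\<lambda>y. \<iota> (gi * \<delta> (inv \<tau> (conj_by g y)))) \<iota> (\<mu> a)"
    by simp
  have C: "tensor_map3 scaleH (\<lambda>x. \<iota> (- (g * x))) (\<lambda>y. \<iota> (gi * \<delta> (inv \<tau> (conj_by g y)))) \<iota> (\<mu> a)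
    \<oplus>\<^sub>t tensor_map3 scaleH (\<lambda>x. \<iota> (g * x)) (\<lambda>y. \<iota> (gi * \<delta> (inv \<tau> (conj_by g y)))) \<iota> (\<mu> a) = tensor_zero scaleH 3"
    using arg_cong[OF map_cancel[of "\<mu> a" "\<lambda>x. g * x" "\<lambda>y. gi * \<delta> (inv \<tau> (conj_by g y))" "\<lambda>w. w"],
        of "tensor_map3 scaleH \<iota> \<iota> \<iota>"]
    by (simp add: map_iota_zero)
  \<comment> \<open>X1 to X5 are the terms of \<mu>(z)\<mu>(a). N comes from \<mu>(\<tau> a)\<mu>(z)
    and N' from \<mu>(\<delta> a): the \<delta> \<tau>^{-1} terms with opposite signs, which cancel
    by \<open>C\<close>.\<close>
  have ac: "X1 \<oplus>\<^sub>t X2 \<oplus>\<^sub>t X3 \<oplus>\<^sub>t X4 \<oplus>\<^sub>t X5 = X1 \<oplus>\<^sub>t X3 \<oplus>\<^sub>t X5 \<oplus>\<^sub>t N \<oplus>\<^sub>t (X2 \<oplus>\<^sub>t X4 \<oplus>\<^sub>t N')"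
    if "N \<oplus>\<^sub>t N' = tensor_zero scaleH 3" "X5 \<in> tensor_power scaleH 3" for X1 X2 X3 X4 X5 N N'
  proof -
    have "X1 \<oplus>\<^sub>t X3 \<oplus>\<^sub>t X5 \<oplus>\<^sub>t N \<oplus>\<^sub>t (X2 \<oplus>\<^sub>t X4 \<oplus>\<^sub>t N') = X1 \<oplus>\<^sub>t X2 \<oplus>\<^sub>t X3 \<oplus>\<^sub>t X4 \<oplus>\<^sub>t (X5 \<oplus>\<^sub>t (N \<oplus>\<^sub>t N'))"
      by (simp only: tensor_add_ac)
    then show ?thesis using that by simp
  qed
  show "tensor3_mult scaleH mu_z (mu_iota a) = tensor3_mult scaleH (mu_iota (\<tau> a)) mu_z \<oplus>\<^sub>t mu_iota (\<delta> a)"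
    unfolding D unfolding mu_iota_def mu_z_times_map[OF mu_closed] map_times_mu_z[OF mu_closed] R1 R2 R3 R4
    by (rule ac[OF C]) simp
qed

section \<open>The extension of \<mu> to H\<close>

lemma mu_iota_zero: "mu_iota 0 = tensor_zero scaleH 3"
  using mu_iota_scale_one[of 0] by (simp add: pure_zero_nth numeral_3_eq_3)

text \<open>Horner's scheme for \<open>\<Sum>\<^sub>i \<iota> a\<^sub>i z\<^sup>i \<mapsto> \<Sum>\<^sub>i \<mu> a\<^sub>i (\<mu> z)\<^sup>i\<close>.\<close>

definition mu_ext :: "'h \<Rightarrow> 'h tensor" where
  "mu_ext h = fold_coeffs (\<lambda>a X. mu_iota a \<oplus>\<^sub>t tensor3_mult scaleH X mu_z) (ore_coeffs h) (tensor_zero scaleH 3)"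

lemma mu_ext_zero [simp]: "mu_ext 0 = tensor_zero scaleH 3"
  by (simp add: mu_ext_def)

lemma mu_ext_shift: "mu_ext (\<iota> a + h * z) = mu_iota a \<oplus>\<^sub>t tensor3_mult scaleH (mu_ext h) mu_z"
\<comment> \<open>\<open>pCons 0 0\<close> is the zero polynomial, on which
  \<open>fold_coeffs\<close> performs no step; the recursion still holds because the step would
  return zero.\<close>
proof (cases "a = 0 \<and> ore_coeffs h = 0")
  case True
  then show ?thesis using ore_coeffs_shift[of a h] by (simp add: mu_ext_def mu_iota_zero H.tensor3_mult_zero)
next
  case False
  then show ?thesis unfolding mu_ext_def ore_coeffs_shift by (cases "a = 0") simp_all
qed

lemma mu_ext_closed [simp]: "mu_ext h \<in> tensor_power scaleH 3"
  by (induction h rule: ore_induct) (simp_all add: mu_ext_shift)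

lemma mu_ext_times_z: "mu_ext (h * z) = tensor3_mult scaleH (mu_ext h) mu_z"
  using mu_ext_shift[of 0 h] by (simp add: mu_iota_zero)

lemma mu_ext_iota: "mu_ext (\<iota> a) = mu_iota a"
  using mu_ext_shift[of a 0] by (simp add: H.tensor3_mult_zero)

lemma mu_ext_one [simp]: "mu_ext 1 = pure scaleH [1, 1, 1]"
  using mu_ext_iota[of 1] by simp

lemma mu_ext_z: "mu_ext z = mu_z"
  using mu_ext_times_z[of 1] by simp

lemma mu_ext_add: "mu_ext (h + h') = mu_ext h \<oplus>\<^sub>t mu_ext h'"
proof (induction h arbitrary: h' rule: ore_induct)
  case (shift a h)
  \<comment> \<open>Both summands are split into Horner form, so the induction hypothesis applies to
    h + k.\<close>
  obtain b k where h': "h' = \<iota> b + k * z"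
    by (cases "ore_coeffs h'") (metis ore_sum_pCons ore_sum_ore_coeffs)
  have "mu_ext (\<iota> a + h * z + h') = mu_ext (\<iota> (a + b) + (h + k) * z)"
    by (simp add: h' iota_add algebra_simps)
  also have "\<dots> = mu_ext (\<iota> a + h * z) \<oplus>\<^sub>t mu_ext h'"
    by (simp add: mu_ext_shift h' shift mu_iota_add H.tensor3_mult_add_left tensor_add_ac)
  finally show ?case .
qed simp

text \<open>Left multiplication by \<iota> a acts directly on the coefficients, so no commutation
  with z is involved.\<close>

lemma mu_ext_iota_mult: "mu_ext (\<iota> a * h) = tensor3_mult scaleH (mu_iota a) (mu_ext h)"
proof (induction h rule: ore_induct)
  case (shift b h)
  have "mu_ext (\<iota> a * (\<iota> b + h * z)) = mu_ext (\<iota> (a * b) + (\<iota> a * h) * z)"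
    by (simp add: iota_mult algebra_simps)
  then show ?case
    by (simp add: mu_ext_shift shift mu_iota_mult H.tensor3_mult_add_right H.tensor3_mult_assoc)
qed (simp add: H.tensor3_mult_zero)

lemma mu_ext_scale: "mu_ext (scaleH c h) = tensor3_scale scaleH c (mu_ext h)"
  using mu_ext_iota_mult[of "scaleA c 1" h]
  by (simp add: scaleH_eq[symmetric] mu_iota_scale_one H.tensor3_scale_mult)

context
  assumes mu_z_commutes
begin

text \<open>Passing z over the leading coefficient b costs \<tau> b and \<delta> b;
  \<open>mu_z_commutes\<close> pays the same price for \<open>mu_z\<close> and
  \<open>mu_iota b\<close>. The trailing z stays on the right, so the remaining part is the
  induction hypothesis.\<close>

lemma mu_ext_z_mult: "mu_ext (z * h) = tensor3_mult scaleH mu_z (mu_ext h)"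
proof (induction h rule: ore_induct)
  case (shift b h)
  have "z * (\<iota> b + h * z) = (z * \<iota> b) + z * h * z"
    by (simp add: algebra_simps)
  then have "mu_ext (z * (\<iota> b + h * z)) = mu_ext (\<iota> (\<delta> b) + (\<iota> (\<tau> b) + z * h) * z)"
    by (simp add: ore_relation algebra_simps)
  also have "\<dots> = (tensor3_mult scaleH (mu_iota (\<tau> b)) mu_z \<oplus>\<^sub>t mu_iota (\<delta> b)) \<oplus>\<^sub>t tensor3_mult scaleH mu_z (tensor3_mult scaleH (mu_ext h) mu_z)"
    by (simp add: mu_ext_times_z mu_ext_add mu_ext_iota shift H.tensor3_mult_add_left H.tensor3_mult_assoc tensor_add_ac)
  also have "\<dots> = tensor3_mult scaleH mu_z (mu_ext (\<iota> b + h * z))"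
    using \<open>mu_z_commutes\<close> by (simp add: mu_z_commutes_def mu_ext_shift H.tensor3_mult_add_right)
  finally show ?case .
qed (simp add: H.tensor3_mult_zero)

text \<open>Regroup (\<iota> a + h z) h' as \<iota> a h' + h (z h'): the induction hypothesis is
  used at z h', hence the arbitrary right factor.\<close>

lemma mu_ext_mult: "mu_ext (h * h') = tensor3_mult scaleH (mu_ext h) (mu_ext h')"
proof (induction h arbitrary: h' rule: ore_induct)
  case (shift a h)
  then show ?case
    by (simp add: distrib_right mult.assoc mu_ext_add mu_ext_iota mu_ext_z mu_ext_iota_mult mu_ext_z_mult
        H.tensor3_mult_add_left H.tensor3_mult_assoc)
qed (simp add: H.tensor3_mult_zero)

section \<open>Coassociativity and the unit laws for the extension\<close>

lemma tensor3_hom_A: "tensor3_hom scaleA \<mu>"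
  by unfold_locales (simp_all add: HG.mu_add HG.mu_scale HG.mu_mult)

lemma tensor3_hom_H: "tensor3_hom scaleH mu_ext"
  by unfold_locales (simp_all add: mu_ext_add mu_ext_scale mu_ext_mult)

interpretation TA: tensor3_hom scaleA \<mu> by (rule tensor3_hom_A)
interpretation TH: tensor3_hom scaleH mu_ext by (rule tensor3_hom_H)

text \<open>Coassociativity is transported along the fifth tensor power of \<iota>, called
  \<open>map5\<close> in the proof, which intertwines the two iterates over A with those over
  H.\<close>

lemma coassoc_iota: "TH.mu_left (mu_ext (\<iota> a)) = TH.mu_right (mu_ext (\<iota> a))"
proof -
  define map5 where "map5 = tensor_lift scaleH 5 (\<lambda>w. pure scaleH (map (\<lambda>i. \<iota> (w ! i)) [0..<5]))"
  have m: "multilinear_into scaleA 5 scaleH 5 (\<lambda>w. pure scaleH (map (\<lambda>i. \<iota> (w ! i)) [0..<5]))"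
    by (rule multilinear_into_pure_map) simp
  have map5_pure: "map5 (pure scaleA [a, b, c, d, e]) = pure scaleH [\<iota> a, \<iota> b, \<iota> c, \<iota> d, \<iota> e]" for a b c d e
  proof -
    have "length [a, b, c, d, e] = 5" by simp
    then have "map5 (pure scaleA [a, b, c, d, e]) = pure scaleH (map (\<lambda>i. \<iota> ([a, b, c, d, e] ! i)) [0..<5])"
      unfolding map5_def by (intro tensor_lift_pure) (simp only: m)
    then show ?thesis by (simp add: upt_conv_Cons)
  qed
  note map5_add = tensor_lift_add[OF m, folded map5_def]
  note simps = TA.trilinear_into_pure5[THEN tensor_lift3_pure] TH.trilinear_into_pure5[THEN tensor_lift3_pure]
    TA.trilinear_into_pure5[THEN tensor_lift3_add] TH.trilinear_into_pure5[THEN tensor_lift3_add]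
    TA.trilinear_into_pure5[THEN tensor_lift3_in_tensor_power] map5_pure map5_add
  have 1: "tensor_lift3 scaleH 5 (\<lambda>x y w. pure scaleH [x, y, w, \<iota> b, \<iota> c]) (tensor_map3 scaleH \<iota> \<iota> \<iota> X)
      = map5 (tensor_lift3 scaleA 5 (\<lambda>x y w. pure scaleA [x, y, w, b, c]) X)"
    and 2: "tensor_lift3 scaleH 5 (\<lambda>x y w. pure scaleH [\<iota> b, \<iota> c, x, y, w]) (tensor_map3 scaleH \<iota> \<iota> \<iota> X)
      = map5 (tensor_lift3 scaleA 5 (\<lambda>x y w. pure scaleA [b, c, x, y, w]) X)"
    if "X \<in> tensor_power scaleA 3" for X b c
    using that by (induction rule: tensor_power3_induct) (simp_all add: simps)
  have "TH.mu_left (tensor_map3 scaleH \<iota> \<iota> \<iota> X) = map5 (TA.mu_left X)"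
    and "TH.mu_right (tensor_map3 scaleH \<iota> \<iota> \<iota> X) = map5 (TA.mu_right X)"
    if "X \<in> tensor_power scaleA 3" for X
    using that
    by (induction rule: tensor_power3_induct)
       (simp_all add: TH.mu_left_pure TA.mu_left_pure TH.mu_right_pure TA.mu_right_pure
         TH.mu_left_add TA.mu_left_add TH.mu_right_add TA.mu_right_add
         mu_ext_iota mu_iota_def 1 2 map5_add)
  moreover have "TA.mu_left (\<mu> a) = TA.mu_right (\<mu> a)"
    using HG.mu_coassoc by (simp add: TA.mu_left_def TA.mu_right_def)
  ultimately show ?thesis by (simp add: mu_ext_iota mu_iota_def)
qed

lemma mu_iota_g: "mu_iota g = pure scaleH [\<iota> g, \<iota> gi, \<iota> g]"
  by (simp add: mu_iota_def mu_g)

lemma mu_iota_minus_g: "mu_iota (- g) = pure scaleH [\<iota> (- g), \<iota> gi, \<iota> g]"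
proof -
  have "\<mu> (- g) = pure scaleA [- g, gi, g]"
    using HG.mu_scale[of "- 1" g] by (simp add: mu_g A.tensor3_scale_map3 A.linear_scale)
  then show ?thesis by (simp add: mu_iota_def)
qed

text \<open>Both sides expand to the same five terms; group-likeness of g produces g \<otimes>
  g^{-1} \<otimes> g \<otimes> g^{-1} \<otimes> z and its signed partner on the left.\<close>

lemma coassoc_z: "TH.mu_left (mu_ext z) = TH.mu_right (mu_ext z)"
proof -
  \<comment> \<open>The left side carries -g in the first position, the right side in the third;
    moving the scalar -1 reconciles them.\<close>
  have sign: "pure scaleH [a, b, - c, d, e] = pure scaleH [- a, b, c, d, e]" for a b c d e
    using pure_scale_nth(2)[of scaleH a b "- 1" c "[d, e]"] by simp
  show ?thesis
    unfolding mu_ext_z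
    by (subst (1 2) mu_z_def)
       (simp add: TH.mu_left_pure TH.mu_right_pure TH.mu_left_add TH.mu_right_add
         mu_ext_z mu_ext_iota mu_iota_g mu_iota_minus_g, simp add: mu_z_def TH.trilinear_into_pure5[THEN tensor_lift3_pure]
         TH.trilinear_into_pure5[THEN tensor_lift3_add] sign tensor_add_ac iota_uminus)
qed

lemma counit_left_mu_ext: "H.counit_left (mu_ext h) = pure scaleH [1, h]"
proof (induction h rule: ore_induct)
  case zero
  have "tensor_zero scaleH 3 = pure scaleH [0, 0, 0]" by (simp add: pure_zero_nth numeral_3_eq_3)
  then show ?case by (simp add: H.counit_left_pure) (simp add: pure_zero_nth)
next
  case (shift a h)
  have "H.counit_left (tensor_map3 scaleH \<iota> \<iota> \<iota> X) = tensor_map2 scaleH \<iota> \<iota> (A.counit_left X)"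
    if "X \<in> tensor_power scaleA 3" for X
    using that
    by (induction rule: tensor_power3_induct)
       (simp_all add: H.counit_left_pure A.counit_left_pure H.counit_left_add A.counit_left_add
          tensor_map2[OF iota_linear iota_linear] iota_mult)
  moreover have "A.counit_left (\<mu> a) = pure scaleA [1, a]"
    using HG.mu_counit_left by (simp add: A.counit_left_def)
  ultimately have 1: "H.counit_left (mu_iota a) = pure scaleH [1, \<iota> a]"
    by (simp add: mu_iota_def tensor_map2[OF iota_linear iota_linear])
  \<comment> \<open>The contraction gives z \<otimes> 1 + 1 \<otimes> z - z \<otimes> 1.\<close>
  have "H.counit_left mu_z = pure scaleH [1, z]"
  proof -
    have "H.counit_left mu_z = (pure scaleH [z, 1] \<oplus>\<^sub>t pure scaleH [- z, 1]) \<oplus>\<^sub>t pure scaleH [1, z]"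
      by (simp add: mu_z_def H.counit_left_add H.counit_left_pure iota_uminus tensor_add_ac
            flip: iota_mult mult.assoc)
    also have "\<dots> = pure scaleH [1, z]"
      unfolding pure_add_nth(1)[symmetric] by (simp add: pure_zero_nth flip: numeral_2_eq_2)
    finally show ?thesis .
  qed
  from H.counit_left_mult[OF mu_ext_closed mu_z_closed this]
  show ?case
    by (simp add: mu_ext_shift H.counit_left_add 1 shift tensor_map2[OF H.linear_ident H.linear_mult_right] flip: pure_add_nth)
qed

lemma counit_right_mu_ext: "H.counit_right (mu_ext h) = pure scaleH [h, 1]"
proof (induction h rule: ore_induct)
  case zero
  have "tensor_zero scaleH 3 = pure scaleH [0, 0, 0]" by (simp add: pure_zero_nth numeral_3_eq_3)
  then show ?case by (simp add: H.counit_right_pure) (simp add: pure_zero_nth)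
next
  case (shift a h)
  have "H.counit_right (tensor_map3 scaleH \<iota> \<iota> \<iota> X) = tensor_map2 scaleH \<iota> \<iota> (A.counit_right X)"
    if "X \<in> tensor_power scaleA 3" for X
    using that
    by (induction rule: tensor_power3_induct)
       (simp_all add: H.counit_right_pure A.counit_right_pure H.counit_right_add A.counit_right_add
          tensor_map2[OF iota_linear iota_linear] iota_mult)
  moreover have "A.counit_right (\<mu> a) = pure scaleA [a, 1]"
    using HG.mu_counit_right by (simp add: A.counit_right_def)
  ultimately have 1: "H.counit_right (mu_iota a) = pure scaleH [\<iota> a, 1]"
    by (simp add: mu_iota_def tensor_map2[OF iota_linear iota_linear])
  \<comment> \<open>Now the second and third terms cancel: both contract to g \<otimes> g^{-1} z up
    to sign.\<close>
  have "H.counit_right mu_z = pure scaleH [z, 1]"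
  proof -
    have "H.counit_right mu_z = pure scaleH [z, 1] \<oplus>\<^sub>t (pure scaleH [\<iota> g, \<iota> gi * z] \<oplus>\<^sub>t pure scaleH [- \<iota> g, \<iota> gi * z])"
      by (simp add: mu_z_def H.counit_right_add H.counit_right_pure iota_uminus tensor_add_assoc)
    also have "\<dots> = pure scaleH [z, 1]"
      unfolding pure_add_nth(1)[symmetric] by (simp add: pure_zero_nth flip: numeral_2_eq_2)
    finally show ?thesis .
  qed
  \<comment> \<open>The inner factor is now \<open>mu_ext h\<close>, so the induction hypothesis is
    a premise of the product rule and the law for \<open>mu_z\<close> evaluates the result; in the
    left law these roles are exchanged.\<close>
  then have "H.counit_right (tensor3_mult scaleH (mu_ext h) mu_z) = pure scaleH [h * z, 1]"
    using H.counit_right_mult[OF mu_ext_closed mu_z_closed shift]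
    by (simp add: tensor_map2[OF H.linear_mult_left H.linear_ident])
  then show ?case
    by (simp add: mu_ext_shift H.counit_right_add 1 flip: pure_add_nth)
qed

lemma hopf_galois_mu_ext: "hopf_galois_algebra scaleH mu_ext"
proof unfold_locales
  fix r
  have "TH.mu_left (mu_ext r) = TH.mu_right (mu_ext r)"
  proof (induction r rule: ore_induct)
    case zero
    show ?case using coassoc_iota[of 0] by simp
  next
    case (shift a h)
    then show ?case
      using TH.coassoc_mult[OF shift coassoc_z] coassoc_iota[of a]
      by (simp add: mu_ext_add TH.mu_left_add TH.mu_right_add)
  qed
  then show "tensor_lift3 scaleH 5 (\<lambda>a b c. tensor_lift3 scaleH 5 (\<lambda>x y z. pure scaleH [x, y, z, b, c]) (mu_ext a)) (mu_ext r)
     = tensor_lift3 scaleH 5 (\<lambda>a b c. tensor_lift3 scaleH 5 (\<lambda>x y z. pure scaleH [a, b, x, y, z]) (mu_ext c)) (mu_ext r)"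
    by (simp add: TH.mu_left_def TH.mu_right_def)
  show "tensor_lift3 scaleH 2 (\<lambda>a b c. pure scaleH [a * b, c]) (mu_ext r) = pure scaleH [1, r]"
    using counit_left_mu_ext by (simp add: H.counit_left_def)
  show "tensor_lift3 scaleH 2 (\<lambda>a b c. pure scaleH [a, b * c]) (mu_ext r) = pure scaleH [r, 1]"
    using counit_right_mu_ext by (simp add: H.counit_right_def)
qed (simp_all add: mu_ext_add mu_ext_scale mu_ext_mult)

lemma hopf_galois_ore_extension_mu_ext: "hopf_galois_ore_extension scaleA \<mu> \<tau> \<delta> scaleH \<iota> z mu_ext"
  unfolding hopf_galois_ore_extension_def
  using HG.hopf_galois_algebra_axioms ore_extension_axioms hopf_galois_mu_ext
  by (simp add: mu_ext_iota mu_iota_def tensor_map3_def)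

end

section \<open>Necessity of the commutation and uniqueness of the extension\<close>

lemma hopf_galois_ore_extension_iota:
  "hopf_galois_ore_extension scaleA \<mu> \<tau> \<delta> scaleH \<iota> z \<nu> \<Longrightarrow> \<nu> (\<iota> a) = mu_iota a"
  by (simp add: hopf_galois_ore_extension_def mu_iota_def tensor_map3_def)

lemma hopf_galois_ore_extension_imp_mu_z_commutes:
  assumes "hopf_galois_ore_extension scaleA \<mu> \<tau> \<delta> scaleH \<iota> z \<nu>" "\<nu> z = mu_z"
  shows mu_z_commutes
  unfolding mu_z_commutes_def
proof
  fix a
  interpret N: hopf_galois_algebra scaleH \<nu>
    using assms(1) by (simp add: hopf_galois_ore_extension_def)
  have "\<nu> (z * \<iota> a) = \<nu> (\<iota> (\<tau> a) * z + \<iota> (\<delta> a))" by (simp only: ore_relation)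
  then show "tensor3_mult scaleH mu_z (mu_iota a) = tensor3_mult scaleH (mu_iota (\<tau> a)) mu_z \<oplus>\<^sub>t mu_iota (\<delta> a)"
    by (simp add: N.mu_mult N.mu_add assms(2) hopf_galois_ore_extension_iota[OF assms(1)])
qed

text \<open>This is the sense in which the value at z determines the map: every element arises by
  steps \<iota> a + h z, on which additivity and multiplicativity fix the value.\<close>

lemma hopf_galois_ore_extension_unique:
  assumes "hopf_galois_ore_extension scaleA \<mu> \<tau> \<delta> scaleH \<iota> z \<nu>" "\<nu> z = mu_z"
  shows "\<nu> = mu_ext"
proof
  fix h
  interpret N: hopf_galois_algebra scaleH \<nu>
    using assms(1) by (simp add: hopf_galois_ore_extension_def)
  note iota = hopf_galois_ore_extension_iota[OF assms(1)]
  show "\<nu> h = mu_ext h"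
  proof (induction h rule: ore_induct)
    case zero
    then show ?case using iota[of 0] by (simp add: mu_iota_zero)
  next
    case (shift a h)
    then show ?case by (simp add: N.mu_add N.mu_mult iota assms(2) mu_ext_shift)
  qed
qed

lemma ex1_hopf_galois_ore_extension_iff:
  "(\<exists>!\<nu>. hopf_galois_ore_extension scaleA \<mu> \<tau> \<delta> scaleH \<iota> z \<nu> \<and> \<nu> z = mu_z)
    \<longleftrightarrow> condition1 \<and> condition2 \<and> condition3"
proof
  assume "\<exists>!\<nu>. hopf_galois_ore_extension scaleA \<mu> \<tau> \<delta> scaleH \<iota> z \<nu> \<and> \<nu> z = mu_z"
  then obtain \<nu> where "hopf_galois_ore_extension scaleA \<mu> \<tau> \<delta> scaleH \<iota> z \<nu>" "\<nu> z = mu_z"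
    by (elim ex1E conjE)
  then have mu_z_commutes by (rule hopf_galois_ore_extension_imp_mu_z_commutes)
  then show "condition1 \<and> condition2 \<and> condition3"
    by (intro conjI mu_z_commutes_imp_conditions)
next
  assume "condition1 \<and> condition2 \<and> condition3"
  then have mu_z_commutes by (elim conjE) (rule conditions_imp_mu_z_commutes)
  show "\<exists>!\<nu>. hopf_galois_ore_extension scaleA \<mu> \<tau> \<delta> scaleH \<iota> z \<nu> \<and> \<nu> z = mu_z"
  proof (intro ex1I[of _ mu_ext] conjI)
    show "hopf_galois_ore_extension scaleA \<mu> \<tau> \<delta> scaleH \<iota> z mu_ext"
      using \<open>mu_z_commutes\<close> by (rule hopf_galois_ore_extension_mu_ext)
    fix \<nu> assume "hopf_galois_ore_extension scaleA \<mu> \<tau> \<delta> scaleH \<iota> z \<nu> \<and> \<nu> z = mu_z"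
    then show "\<nu> = mu_ext" by (elim conjE) (rule hopf_galois_ore_extension_unique)
  qed (rule mu_ext_z)
qed

end

theorem theorem2p8:
  fixes scaleA :: "'k::field \<Rightarrow> 'a::ring_1 \<Rightarrow> 'a"
    and scaleH :: "'k \<Rightarrow> 'h::ring_1 \<Rightarrow> 'h"
    and \<mu> :: "'a \<Rightarrow> 'a tensor"
    and \<tau> \<delta> :: "'a \<Rightarrow> 'a"
    and \<iota> :: "'a \<Rightarrow> 'h"
    and z :: 'h
    and g :: 'a
  assumes "hopf_galois_algebra scaleA \<mu>"
    and "ore_extension scaleA \<tau> \<delta> scaleH \<iota> z"
    and "group_like scaleA \<mu> g"
    and "bij \<tau>"
  shows "(\<exists>!\<mu>\<^sub>H. hopf_galois_ore_extension scaleA \<mu> \<tau> \<delta> scaleH \<iota> z \<mu>\<^sub>H \<and>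
            \<mu>\<^sub>H z = pure scaleH [z, 1, 1] \<oplus>\<^sub>t pure scaleH [\<iota> g, \<iota> (inv_elt g), z]
                    \<ominus>\<^sub>t pure scaleH [\<iota> g, \<iota> (inv_elt g) * z, 1])
     \<longleftrightarrow>
         (\<forall>a.
            (\<mu> (\<tau> a) = tensor_lift3 scaleA 3 (\<lambda>x y w. pure scaleA [\<tau> x, y, w]) (\<mu> a) \<and>
             \<mu> (\<tau> a) = tensor_lift3 scaleA 3 (\<lambda>x y w. pure scaleA [\<tau> x, \<tau> y, \<tau> w]) (\<mu> a))
          \<and> tensor_lift3 scaleA 3 (\<lambda>x y w. pure scaleA [conj_by g x, conj_by g y, w]) (\<mu> a)
              = tensor_lift3 scaleA 3 (\<lambda>x y w. pure scaleA [\<tau> x, \<tau> y, w]) (\<mu> a)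
          \<and> tensor_lift3 scaleA 3 (\<lambda>x y w. pure scaleA [\<delta> x, y, w]) (\<mu> a)
              \<oplus>\<^sub>t tensor_lift3 scaleA 3 (\<lambda>x y w. pure scaleA [g * x, y * inv_elt g, \<delta> w]) (\<mu> a)
              \<oplus>\<^sub>t tensor_lift3 scaleA 3
                  (\<lambda>x y w. pure scaleA [g * x, inv_elt g * \<delta> (inv \<tau> (conj_by g y)), w]) (\<mu> a)
              = \<mu> (\<delta> a))"
proof -
  interpret O: ore_extension_of_hopf_galois scaleA \<tau> \<delta> scaleH \<iota> z \<mu> g
    using assms by (intro ore_extension_of_hopf_galois.intro ore_extension_of_hopf_galois_axioms.intro)
  show ?thesis
    using O.ex1_hopf_galois_ore_extension_iff
    unfolding O.mu_z_eq O.condition1_def O.condition2_def O.condition3_def tensor_map3_def all_conj_distrib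
    by (simp only: conj_assoc)
qed

end
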